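(* There exist an open starshaped planar domain $\Omega\subset(-1,1)^2$ which is not a disk, a nonempty, connected, (relatively open) analytic subset $\Gamma$ of $\partial\Omega$, a constant $c>0$, and a function $u\in\mathcal{C}^0(\overline{\Omega})\cap\mathcal{C}^1(\Omega\cup\Gamma)\cap\mathcal{C}^2(\Omega)$ such that $$\left\{\begin{array}{ll}-\Delta u=1 & \text{in }\Omega,\\ u=0 & \text{on }\partial\Omega,\\ u_\nu=-c & \text{on }\Gamma.\end{array}\right.$$
   Context: A planar domain is a nonempty connected open subset of $\mathbb{R}^2$. It is starshaped if it is starshaped with respect to some point of it. A subset $\Gamma\subset\partial\Omega$ is analytic if it is relatively open in $\partial\Omega$ and is a real-analytic curve (embedded one-dimensional real-analytic submanifold of $\mathbb{R}^2$). Here $\nu$ denotes the unit outer normal to $\partial\Omega$ and $u_\nu$ the normal derivative of $u$ on $\partial\Omega$ (only needed on $\Gamma$). The notation $u\in\mathcal{C}^1(\Omega\cup\Gamma)$ means that $u$ is $\mathcal{C}^1$ up to the boundary portion $\Gamma$. *)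

theory Defs
  imports "HOL-Analysis.Analysis"
begin

section \<open>Planar domains and analytic boundary portions\<close>

definition planar_domain :: "(real ^ 2) set \<Rightarrow> bool" where
  "planar_domain \<Omega> \<longleftrightarrow> open \<Omega> \<and> connected \<Omega> \<and> \<Omega> \<noteq> {}"

definition real_analytic_on :: "(real \<Rightarrow> 'a::real_normed_vector) \<Rightarrow> real set \<Rightarrow> bool"
    (infixl \<open>real'_analytic'_on\<close> 50) where
  "f real_analytic_on S \<longleftrightarrow>
     (\<forall>t0\<in>S. \<exists>a r. r > 0 \<and>
        (\<forall>t. \<bar>t - t0\<bar> < r \<longrightarrow> (\<lambda>n. (t - t0) ^ n *\<^sub>R a n) sums f t))"

text \<open>
  Embedded one-dimensional real-analytic submanifold of the plane: near each of its points,
  \<open>\<Gamma>\<close> is the homeomorphic image of an open interval under a regular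
  real-analytic parametrization.
\<close>
definition real_analytic_curve :: "(real ^ 2) set \<Rightarrow> bool" where
  "real_analytic_curve \<Gamma> \<longleftrightarrow>
     (\<forall>p\<in>\<Gamma>. \<exists>U a b \<gamma> \<delta>. open U \<and> p \<in> U \<and>
        homeomorphism {a<..<b} (\<Gamma> \<inter> U) \<gamma> \<delta> \<and>
        \<gamma> real_analytic_on {a<..<b} \<and>
        (\<forall>t\<in>{a<..<b}. vector_derivative \<gamma> (at t) \<noteq> 0))"

definition analytic_boundary_subset :: "(real ^ 2) set \<Rightarrow> (real ^ 2) set \<Rightarrow> bool" where
  "analytic_boundary_subset \<Omega> \<Gamma> \<longleftrightarrow>
     openin (top_of_set (frontier \<Omega>)) \<Gamma> \<and> real_analytic_curve \<Gamma>"

section \<open>Derivatives and regularity classes\<close>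

definition partial_derivative :: "'n::finite \<Rightarrow> (real ^ 'n \<Rightarrow> real) \<Rightarrow> real ^ 'n \<Rightarrow> real" where
  "partial_derivative i u x = frechet_derivative u (at x) (axis i 1)"

definition grad :: "(real ^ 'n::finite \<Rightarrow> real) \<Rightarrow> real ^ 'n \<Rightarrow> real ^ 'n" where
  "grad u x = (\<chi> i. partial_derivative i u x)"

definition laplacian :: "(real ^ 'n::finite \<Rightarrow> real) \<Rightarrow> real ^ 'n \<Rightarrow> real" where
  "laplacian u x = (\<Sum>i\<in>UNIV. partial_derivative i (partial_derivative i u) x)"

text \<open>The class of k times continuously differentiable functions; meant for open sets.\<close>
fun Ck_on :: "nat \<Rightarrow> (real ^ 'n::finite \<Rightarrow> real) \<Rightarrow> (real ^ 'n) set \<Rightarrow> bool" where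
  "Ck_on 0 u S \<longleftrightarrow> continuous_on S u"
| "Ck_on (Suc k) u S \<longleftrightarrow>
     (\<forall>x\<in>S. u differentiable (at x)) \<and> (\<forall>i. Ck_on k (partial_derivative i u) S)"

text \<open>
  Continuous differentiability up to the boundary portion \<open>\<Gamma>\<close>: the function is
  continuous on \<open>\<Omega> \<union> \<Gamma>\<close>, and its first derivatives in the open set
  \<open>\<Omega>\<close> extend continuously to \<open>\<Omega> \<union> \<Gamma>\<close>.
\<close>
definition C1_up_to ::
    "(real ^ 'n::finite \<Rightarrow> real) \<Rightarrow> (real ^ 'n) set \<Rightarrow> (real ^ 'n) set \<Rightarrow> bool" where
  "C1_up_to u \<Omega> \<Gamma> \<longleftrightarrow>
     Ck_on 1 u \<Omega> \<and> continuous_on (\<Omega> \<union> \<Gamma>) u \<and>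
     (\<forall>i. \<exists>g. continuous_on (\<Omega> \<union> \<Gamma>) g \<and> (\<forall>x\<in>\<Omega>. g x = partial_derivative i u x))"

section \<open>Outer normal and normal derivative\<close>

text \<open>
  Velocity vectors at \<open>p\<close> of curves in \<open>M\<close>; this is the usual tangent space when
  \<open>M\<close> is an embedded submanifold near \<open>p\<close>.
\<close>
definition tangent_vectors :: "(real ^ 2) set \<Rightarrow> real ^ 2 \<Rightarrow> (real ^ 2) set" where
  "tangent_vectors M p =
     {v. \<exists>\<gamma> e. e > 0 \<and> \<gamma> ` {-e<..<e} \<subseteq> M \<and> \<gamma> 0 = p \<and>
              (\<gamma> has_vector_derivative v) (at (0::real))}"

text \<open>
  The last condition forces \<open>\<Omega>\<close> to lie on exactly one side of its boundary at
  \<open>p\<close>, so that a slit, for instance, has no outer normal.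
\<close>
definition is_unit_outer_normal :: "(real ^ 2) set \<Rightarrow> real ^ 2 \<Rightarrow> real ^ 2 \<Rightarrow> bool" where
  "is_unit_outer_normal \<Omega> p \<nu> \<longleftrightarrow>
     norm \<nu> = 1 \<and>
     (\<forall>v\<in>tangent_vectors (frontier \<Omega>) p. \<nu> \<bullet> v = 0) \<and>
     (\<forall>\<^sub>F t in at_right 0. p - t *\<^sub>R \<nu> \<in> \<Omega> \<and> p + t *\<^sub>R \<nu> \<notin> closure \<Omega>)"

text \<open>
  The normal derivative at a boundary point pairs the unit outer normal with the boundary value
  of the gradient, the latter being the limit from inside \<open>\<Omega>\<close>. It is a relation, so
  that asserting a value includes the existence of the normal and of the limit.
\<close>
definition has_normal_derivative ::
    "(real ^ 2 \<Rightarrow> real) \<Rightarrow> real \<Rightarrow> (real ^ 2) set \<Rightarrow> real ^ 2 \<Rightarrow> bool" where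
  "has_normal_derivative u d \<Omega> p \<longleftrightarrow>
     (\<exists>\<nu> g. is_unit_outer_normal \<Omega> p \<nu> \<and> (grad u \<longlongrightarrow> g) (at p within \<Omega>) \<and> g \<bullet> \<nu> = d)"

end

theory Submission
  imports Defs "HOL-Complex_Analysis.Complex_Analysis"
begin

text \<open>
  The example is a perturbation of the unit disk. Write \<open>u = Re F - |z|\<^sup>2/4\<close> with \<open>F\<close>
  holomorphic. If an analytic arc has Schwarz function \<open>S\<close> (so \<open>cnj z = S z\<close> on it) and
  conjugate unit normal \<open>\<sigma>\<close> (so \<open>\<sigma>\<^sup>2 = - S'\<close>), then \<open>u = 0\<close> and \<open>u\<^sub>\<nu> = - 1/2\<close> on the arc
  as soon as \<open>F' = (S - \<sigma>)/2\<close>. With \<open>z = tanh s\<close> the unit disk is the strip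
  \<open>|Im s| < \<pi>/4\<close>; bend its lower edge by \<open>z = tanh (s + k s)\<close>, where \<open>k\<close> is small, imaginary
  on that edge and vanishes doubly at \<open>0\<close>. Then \<open>S = coth (s - k s)\<close>, the poles of \<open>S\<close> and
  \<open>\<sigma>\<close> at the centre cancel, and \<open>F'\<close> is holomorphic and small on the plane slit along
  \<open>{x \<in> \<real>. |x| \<ge> 1}\<close>. Hence \<open>u\<close> is radially decreasing away from \<open>0\<close>, so \<open>{u > 0}\<close> is
  starshaped, and the perturbed lower semicircle is an open part of its boundary. The upper
  part is only a level curve; \<open>F\<close> is singular at \<open>\<plusminus>1\<close>, where the two parts meet.
\<close>

section \<open>The slit plane\<close>

definition slit_plane :: "complex set" where
  "slit_plane = {z. Im z \<noteq> 0 \<or> \<bar>Re z\<bar> < 1}"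

lemma open_slit_plane: "open slit_plane"
proof -
  have "slit_plane = {z. Im z < 0} \<union> {z. Im z > 0} \<union> ({z. Re z < 1} \<inter> {z. Re z > -1})"
    by (auto simp: slit_plane_def)
  moreover have "open \<dots>"
    by (intro open_Un open_Int open_halfspace_Im_lt open_halfspace_Im_gt
        open_halfspace_Re_lt open_halfspace_Re_gt)
  ultimately show ?thesis by simp
qed

text \<open>A real point of the segment is either the endpoint \<open>x\<close>, or \<open>z\<close>
  is real too and both ends lie in the interval from -1 to 1. Any such \<open>x\<close> can serve as
  star centre, so centres may be chosen close to the tips of the slits.\<close>

lemma closed_segment_slit_plane:
  assumes "z \<in> slit_plane" "\<bar>x\<bar> < 1"
  shows "closed_segment (of_real x) z \<subseteq> slit_plane"
proof
  fix w assume "w \<in> closed_segment (of_real x) z"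
  then obtain u where u: "0 \<le> u" "u \<le> 1" and w: "w = (1 - u) *\<^sub>R of_real x + u *\<^sub>R z"
    by (auto simp: in_segment)
  have Im: "Im w = u * Im z" and Re: "Re w = (1 - u) * x + u * Re z"
    by (simp_all add: w)
  show "w \<in> slit_plane"
  proof (cases "Im w = 0")
    case True
    then consider "u = 0" | "Im z = 0"
      using Im by auto
    then have "\<bar>Re w\<bar> < 1"
    proof cases
      case 1
      then show ?thesis using Re assms by simp
    next
      case 2
      then have "\<bar>Re z\<bar> < 1" using assms by (auto simp: slit_plane_def)
      then have "w \<in> closed_segment (of_real x) z" "Re z \<in> {-1<..<1}" "x \<in> {-1<..<1}"
        using assms w u by (auto simp: in_segment)
      then have "(1 - u) *\<^sub>R x + u *\<^sub>R Re z \<in> {-1<..<1}"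
        using u convexD[OF convex_real_interval(8)[of "-1" 1], of x "Re z" "1 - u" u] by simp
      then show ?thesis using Re by auto
    qed
    then show ?thesis by (auto simp: slit_plane_def)
  qed (auto simp: slit_plane_def)
qed

lemma starlike_slit_plane: "starlike slit_plane"
  unfolding starlike_def using closed_segment_slit_plane[of _ 0]
  by (intro bexI[of _ 0]) (auto simp: slit_plane_def)

lemma scaleR_slit_plane:
  assumes "z \<in> slit_plane" "0 \<le> r" "r \<le> 1"
  shows "r *\<^sub>R z \<in> slit_plane"
proof -
  have "r *\<^sub>R z \<in> closed_segment 0 z"
    using assms by (auto simp: in_segment)
  then show ?thesis using closed_segment_slit_plane[OF assms(1), of 0] by auto
qed

lemma ray_in_closure:
  fixes z :: complex
  assumes "\<And>r. r \<in> {0<..<1} \<Longrightarrow> r *\<^sub>R z \<in> S"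
  shows "z \<in> closure S"
proof (rule Lim_in_closed_set[OF closed_closure])
  show "\<forall>\<^sub>F r in at_left (1::real). r *\<^sub>R z \<in> closure S"
    by (rule eventually_mono[OF eventually_at_left_real[of 0 1]])
       (use assms closure_subset in auto)
  have "((\<lambda>r. r *\<^sub>R z) \<longlongrightarrow> 1 *\<^sub>R z) (at_left 1)"
    by (intro tendsto_intros)
  then show "((\<lambda>r. r *\<^sub>R z) \<longlongrightarrow> z) (at_left 1)" by simp
qed simp

lemma open_Im_strip: "open {z. \<bar>Im z\<bar> < a}" and convex_Im_strip: "convex {z. \<bar>Im z\<bar> < a}"
proof -
  have eq: "{z. \<bar>Im z\<bar> < a} = {z. Im z < a} \<inter> {z. Im z > -a}" by auto
  show "open {z. \<bar>Im z\<bar> < a}"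
    unfolding eq by (intro open_Int open_halfspace_Im_lt open_halfspace_Im_gt)
  show "convex {z. \<bar>Im z\<bar> < a}"
    unfolding eq by (intro convex_Int convex_halfspace_Im_lt convex_halfspace_Im_gt)
qed

section \<open>Hyperbolic functions of a complex variable\<close>

text \<open>Solving \<open>(1 + z) / (1 - z) = t\<close> gives \<open>z = (t - 1) / (t + 1)\<close>,
  which for \<open>t \<le> 0\<close> is real of modulus at least 1. Hence \<open>artanh\<close>
  meets the branch cut of the logarithm only on the slits.\<close>

lemma slit_plane_cayley:
  assumes "z \<in> slit_plane"
  shows "(1 + z) / (1 - z) \<notin> \<real>\<^sub>\<le>\<^sub>0" "z \<noteq> 1" "z \<noteq> -1"
proof -
  show 1: "z \<noteq> 1" "z \<noteq> -1"
    using assms by (auto simp: slit_plane_def)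
  show "(1 + z) / (1 - z) \<notin> \<real>\<^sub>\<le>\<^sub>0"
  proof
    assume "(1 + z) / (1 - z) \<in> \<real>\<^sub>\<le>\<^sub>0"
    then obtain t where t: "t \<le> 0" "(1 + z) / (1 - z) = of_real t"
      by (auto simp: nonpos_Reals_def)
    then have "1 + z = of_real t * (1 - z)"
      using 1 by (simp add: field_simps)
    then have "z * of_real (1 + t) = of_real (t - 1)"
      by (simp add: algebra_simps)
    then have Re: "Re z * (1 + t) = t - 1" and Im: "Im z * (1 + t) = 0"
      by (simp_all add: complex_eq_iff)
    have "1 + t \<noteq> 0" using Re by auto
    then have "\<bar>Re z\<bar> < 1" using Im assms by (auto simp: slit_plane_def)
    then have "\<bar>Re z\<bar> * \<bar>1 + t\<bar> < 1 * \<bar>1 + t\<bar>"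
      using \<open>1 + t \<noteq> 0\<close> by (intro mult_strict_right_mono) auto
    then have "\<bar>t - 1\<bar> < \<bar>1 + t\<bar>"
      using Re by (simp flip: abs_mult)
    then show False using t(1) by linarith
  qed
qed

lemma exp_double_artanh:
  assumes "z \<noteq> 1" "z \<noteq> (-1::complex)"
  shows "exp (2 * artanh z) = (1 + z) / (1 - z)"
proof -
  have "(1 + z) / (1 - z) \<noteq> 0"
    using assms by (simp add: add_eq_0_iff)
  then show ?thesis by (simp add: artanh_def)
qed

lemma tanh_exp_double: "tanh (v::complex) = (exp (2 * v) - 1) / (exp (2 * v) + 1)"
proof -
  have "tanh v = (exp v - exp (-v)) * exp v / ((exp v + exp (-v)) * exp v)"
    by (simp add: tanh_altdef)
  also have "\<dots> = (exp (2 * v) - 1) / (exp (2 * v) + 1)"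
    by (simp add: algebra_simps flip: exp_add)
  finally show ?thesis .
qed

lemma tanh_artanh_complex:
  assumes "z \<noteq> 1" "z \<noteq> (-1::complex)"
  shows "tanh (artanh z) = z"
proof -
  have "tanh (artanh z) = ((1 + z) / (1 - z) - 1) / ((1 + z) / (1 - z) + 1)"
    by (simp add: tanh_exp_double exp_double_artanh[OF assms])
  also have "\<dots> = z" using assms by (simp add: field_simps)
  finally show ?thesis .
qed

lemma abs_Im_artanh:
  assumes "z \<in> slit_plane"
  shows "\<bar>Im (artanh z)\<bar> < pi / 2"
proof -
  let ?w = "(1 + z) / (1 - z)"
  have w: "?w \<notin> \<real>\<^sub>\<le>\<^sub>0" "?w \<noteq> 0" using slit_plane_cayley(1)[OF assms] by auto
  then have "Im (Ln ?w) \<noteq> pi" "- pi < Im (Ln ?w)" "Im (Ln ?w) \<le> pi"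
    using Im_Ln_eq_pi[of ?w] mpi_less_Im_Ln Im_Ln_le_pi
    by (auto simp: complex_nonpos_Reals_iff)
  then show ?thesis by (simp add: artanh_def)
qed

text \<open>The principal logarithm inverts \<open>exp\<close> on this strip, whereas the logarithm
  of a negative number has imaginary part \<open>pi\<close>.\<close>

lemma exp_not_nonpos:
  assumes "\<bar>Im v\<bar> < pi"
  shows "exp v \<notin> \<real>\<^sub>\<le>\<^sub>0"
proof
  assume "exp v \<in> \<real>\<^sub>\<le>\<^sub>0"
  then have "Im (Ln (exp v)) = pi"
    using exp_not_eq_zero[of v]
    by (subst Im_Ln_eq_pi) (auto simp: complex_nonpos_Reals_iff complex_eq_iff
        order_le_less simp del: exp_not_eq_zero)
  then show False using assms by (simp add: Ln_exp)
qed

lemma cosh_nonzero_strip: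
  assumes "\<bar>Im v\<bar> < pi / 2"
  shows "cosh v \<noteq> 0"
proof
  assume "cosh v = 0"
  then have "exp (2 * v) = -1"
    by (simp add: cosh_zero_iff exp_double)
  then show False using exp_not_nonpos[of "2 * v"] assms by (simp add: abs_mult)
qed

lemma sinh_nonzero_strip:
  assumes "\<bar>Im v\<bar> < pi" "v \<noteq> 0"
  shows "sinh v \<noteq> 0"
proof
  assume "sinh v = 0"
  then have "exp v = 1 \<or> exp v = -1" by (simp add: sinh_zero_iff)
  then have "exp v = 1" using exp_not_nonpos[of v] assms by auto
  then have "Ln (exp v) = 0" by simp
  then show False using assms by (simp add: Ln_exp)
qed

lemma artanh_tanh_complex:
  assumes "\<bar>Im v\<bar> < pi / 2"
  shows "artanh (tanh v) = v"
proof -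
  have c: "exp (2 * v) + 1 \<noteq> 0"
    using exp_not_nonpos[of "2 * v"] assms by (auto simp: add_eq_0_iff2 abs_mult)
  have "(1 + tanh v) / (1 - tanh v) = exp (2 * v)"
    using c unfolding tanh_exp_double by (simp add: add_divide_eq_iff diff_divide_eq_iff divide_divide_eq_left)
  then have "artanh (tanh v) = Ln (exp (2 * v)) / 2"
    by (simp add: artanh_def)
  also have "\<dots> = v" using assms by (subst Ln_exp) auto
  finally show ?thesis .
qed

text \<open>If \<open>tanh v\<close> were a real \<open>a\<close> with modulus at least 1, then
  \<open>exp (2 * v) = (1 + a) / (1 - a)\<close> would be nonpositive, against
  \<open>exp_not_nonpos\<close>.\<close>

lemma tanh_in_slit_plane:
  assumes "\<bar>Im v\<bar> < pi / 2"
  shows "tanh v \<in> slit_plane"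
proof (rule ccontr)
  assume "tanh v \<notin> slit_plane"
  then have t: "Im (tanh v) = 0" "\<bar>Re (tanh v)\<bar> \<ge> 1"
    by (auto simp: slit_plane_def)
  then obtain a where a: "tanh v = of_real a" "\<bar>a\<bar> \<ge> 1"
    by (metis complex_is_Real_iff Reals_cases Re_complex_of_real)
  have nn: "exp (2 * v) \<notin> \<real>\<^sub>\<le>\<^sub>0"
    using exp_not_nonpos[of "2 * v"] assms by simp
  then have c: "exp (2 * v) + 1 \<noteq> 0"
    by (auto simp: add_eq_0_iff2)
  then have "exp (2 * v) - 1 = of_real a * (exp (2 * v) + 1)"
    using a(1) by (simp add: tanh_exp_double field_simps)
  then have e: "exp (2 * v) * of_real (1 - a) = of_real (1 + a)"
    by (simp add: algebra_simps)
  then have "a \<noteq> 1" by auto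
  then have "exp (2 * v) = of_real ((1 + a) / (1 - a))"
    using e by (simp add: field_simps del: of_real_add of_real_diff) 
  moreover have "(1 + a) / (1 - a) \<le> 0"
    using a(2) \<open>a \<noteq> 1\<close> by (auto simp: divide_le_0_iff abs_if split: if_splits)
  ultimately show False using nn by (simp add: complex_nonpos_Reals_iff)
qed

lemma holomorphic_on_artanh: "artanh holomorphic_on slit_plane"
  unfolding artanh_def
  by (intro holomorphic_intros) (use slit_plane_cayley in auto)

section \<open>Size estimates for sinh, cosh, tanh, coth and the square root\<close>

lemma third_le_abs_sin:
  fixes y :: real
  assumes "\<bar>y\<bar> \<le> 2"
  shows "\<bar>y\<bar> / 3 \<le> \<bar>sin y\<bar>"
proof -
  have *: "x / 3 \<le> sin x" if x: "0 \<le> x" "x \<le> 2" for x :: real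
  proof -
    have "\<bar>sin x - (\<Sum>m<3. sin_coeff m * x ^ m)\<bar> \<le> inverse (fact 3) * \<bar>x\<bar> ^ 3"
      by (rule Maclaurin_sin_bound)
    then have "\<bar>sin x - x\<bar> \<le> x ^ 3 / 6"
      using x by (simp add: sin_coeff_def eval_nat_numeral)
    \<comment> \<open>With \<open>x \<le> 2\<close> the cubic error is at most
      \<open>2 * x / 3\<close>, which leaves a third of \<open>x\<close>.\<close>
    moreover have "x ^ 3 \<le> x * (2 * 2)"
      unfolding power3_eq_cube mult.assoc using x by (intro mult_mono) auto
    ultimately show ?thesis by linarith
  qed
  show ?thesis
    using *[of y] *[of "-y"] assms by (cases "y \<ge> 0") auto
qed

lemma sinh_eq_Complex:
  "sinh z = Complex (sinh (Re z) * cos (Im z)) (cosh (Re z) * sin (Im z))"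
  by (simp add: complex_eq_iff Re_exp Im_exp sinh_field_def cosh_field_def
      algebra_simps diff_divide_distrib)

lemma cosh_eq_Complex:
  "cosh z = Complex (cosh (Re z) * cos (Im z)) (sinh (Re z) * sin (Im z))"
  by (simp add: complex_eq_iff Re_exp Im_exp sinh_field_def cosh_field_def
      algebra_simps diff_divide_distrib)

lemma norm_sinh_squared: "(norm (sinh z))\<^sup>2 = (sinh (Re z))\<^sup>2 + (sin (Im z))\<^sup>2" for z :: complex
  unfolding sinh_eq_Complex cmod_power2
  by (simp add: power_mult_distrib cosh_square_eq cos_squared_eq algebra_simps)

lemma norm_cosh_squared: "(norm (cosh z))\<^sup>2 = (sinh (Re z))\<^sup>2 + (cos (Im z))\<^sup>2" for z :: complex
  unfolding cosh_eq_Complex cmod_power2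
  by (simp add: power_mult_distrib cosh_square_eq sin_squared_eq algebra_simps)

lemma Im_tanh: "Im (tanh z) = sin (2 * Im z) / (2 * (norm (cosh z))\<^sup>2)"
proof -
  have "tanh z = sinh z * cnj (cosh z) / of_real ((norm (cosh z))\<^sup>2)"
    by (simp add: tanh_def complex_div_cnj[of "sinh z"])
  then have "Im (tanh z) = Im (sinh z * cnj (cosh z)) / (norm (cosh z))\<^sup>2"
    by simp
  also have "Im (sinh z * cnj (cosh z)) = ((cosh (Re z))\<^sup>2 - (sinh (Re z))\<^sup>2) * (sin (Im z) * cos (Im z))"
    by (simp add: sinh_eq_Complex[of z] cosh_eq_Complex[of z] algebra_simps power2_eq_square)
  also have "\<dots> = sin (2 * Im z) / 2"
    by (simp add: hyperbolic_pythagoras sin_double)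
  finally show ?thesis by simp
qed

text \<open>Compare \<open>Im_tanh\<close>: up to the common factor
  \<open>1 / (norm (cosh z))^2\<close>, both quantities depend on \<open>Im z\<close> alone. Hence
  tanh maps horizontal lines into circles through 1 and -1 or into the real axis.\<close>

lemma norm_tanh_squared:
  assumes "cosh z \<noteq> (0::complex)"
  shows "(norm (tanh z))\<^sup>2 - 1 = - cos (2 * Im z) / (norm (cosh z))\<^sup>2"
proof -
  have "(norm (tanh z))\<^sup>2 - 1 = ((norm (sinh z))\<^sup>2 - (norm (cosh z))\<^sup>2) / (norm (cosh z))\<^sup>2"
    using assms by (simp add: tanh_def norm_divide power_divide diff_divide_distrib)
  also have "(norm (sinh z))\<^sup>2 - (norm (cosh z))\<^sup>2 = - cos (2 * Im z)"
    by (simp add: norm_sinh_squared norm_cosh_squared cos_double)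
  finally show ?thesis .
qed

text \<open>\<open>norm (sinh w)\<close> is at least \<open>norm w / 3\<close>, by comparing sinh of
  the real part and sin of the imaginary part with their arguments, and \<open>norm (cosh w)\<close>
  exceeds \<open>norm (sinh w)\<close> by at most 1.\<close>

lemma norm_coth_le:
  fixes w :: complex
  assumes "\<bar>Im w\<bar> \<le> 2" "w \<noteq> 0"
  shows "norm (cosh w / sinh w) \<le> 1 + 3 / norm w"
proof -
  have "\<bar>Im w\<bar> < pi" using assms pi_gt3 by linarith
  then have s0: "sinh w \<noteq> 0" using sinh_nonzero_strip assms by blast
  have sq: "(norm w / 3)\<^sup>2 = (Re w)\<^sup>2 / 9 + (Im w)\<^sup>2 / 9"
    by (simp add: power_divide cmod_power2 add_divide_distrib)
  have "(\<bar>Re w\<bar>)\<^sup>2 \<le> (\<bar>sinh (Re w)\<bar>)\<^sup>2"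
    by (intro power_mono) (use real_le_abs_sinh[of "Re w"] in \<open>auto simp: sinh_field_def exp_minus\<close>)
  moreover have "(\<bar>Im w\<bar> / 3)\<^sup>2 \<le> (\<bar>sin (Im w)\<bar>)\<^sup>2"
    by (intro power_mono third_le_abs_sin assms) auto
  ultimately have "(norm w / 3)\<^sup>2 \<le> (norm (sinh w))\<^sup>2"
    unfolding norm_sinh_squared sq using zero_le_power2[of "Re w"]
    by (simp only: power2_abs power_divide power2_eq_square[of 3])
  then have 1: "norm w / 3 \<le> norm (sinh w)"
    by (rule power2_le_imp_le) simp
  have "(norm (cosh w))\<^sup>2 \<le> (norm (sinh w))\<^sup>2 + 1"
    unfolding norm_sinh_squared norm_cosh_squared by (simp add: cos_squared_eq)
  also have "\<dots> \<le> (norm (sinh w) + 1)\<^sup>2" by (simp add: power2_sum)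
  finally have "norm (cosh w) \<le> norm (sinh w) + 1"
    by (rule power2_le_imp_le) simp
  then have "norm (cosh w / sinh w) \<le> 1 + 1 / norm (sinh w)"
    using s0 by (simp add: norm_divide field_simps)
  also have "1 / norm (sinh w) \<le> 3 / norm w"
    using 1 s0 assms(2) by (simp add: field_simps)
  finally show ?thesis by simp
qed


lemma norm_sinh_le:
  fixes z :: complex
  assumes "norm z \<le> 1/2"
  shows "norm (sinh z) \<le> 2 * norm z" and norm_cosh_minus_one_le: "norm (cosh z - 1) \<le> 2 * norm z"
proof -
  have e: "norm (exp z - 1) \<le> 3/2 * norm z" "norm (exp (-z) - 1) \<le> 3/2 * norm z"
    using norm_exp_bounds(2)[of z] norm_exp_bounds(2)[of "-z"] assms by auto
  have "sinh z = ((exp z - 1) - (exp (-z) - 1)) / 2" by (simp add: sinh_field_def)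
  then have "norm (sinh z) \<le> (norm (exp z - 1) + norm (exp (-z) - 1)) / 2"
    by (metis norm_triangle_ineq4 norm_divide norm_numeral divide_right_mono zero_le_numeral)
  then show "norm (sinh z) \<le> 2 * norm z" using e norm_ge_zero[of z] by argo
  have "cosh z - 1 = ((exp z - 1) + (exp (-z) - 1)) / 2" by (simp add: cosh_field_def field_simps)
  then have "norm (cosh z - 1) \<le> (norm (exp z - 1) + norm (exp (-z) - 1)) / 2"
    by (metis norm_triangle_ineq norm_divide norm_numeral divide_right_mono zero_le_numeral)
  then show "norm (cosh z - 1) \<le> 2 * norm z" using e norm_ge_zero[of z] by argo
qed

text \<open>Factor \<open>q - 1\<close> as a difference of squares; the principal root has
  nonnegative real part, so the second factor has modulus at least 1.\<close>

lemma norm_csqrt_minus_one_le: "norm (csqrt q - 1) \<le> norm (q - 1)"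
proof -
  have "q - 1 = (csqrt q - 1) * (csqrt q + 1)"
    by (simp add: algebra_simps flip: power2_eq_square)
  then have "norm (q - 1) = norm (csqrt q - 1) * norm (csqrt q + 1)"
    by (metis norm_mult)
  moreover have "1 \<le> norm (csqrt q + 1)"
    using complex_Re_le_cmod[of "csqrt q + 1"] Re_csqrt[of q] by (simp del: csqrt.simps)
  ultimately show ?thesis
    by (metis mult.right_neutral mult_left_mono norm_ge_zero)
qed

section \<open>The superlevel domain of the potential\<close>

text \<open>The number \<open>h z - cnj z / 2\<close> is the conjugate of the gradient of
  \<open>u\<close>. So \<open>\<Phi>_zero\<close> and \<open>\<Phi>_grad\<close> are the two
  boundary conditions on the arc, while \<open>h_bound\<close> keeps \<open>u\<close> close to the
  solution \<open>(1 - |z|^2) / 4\<close> of the unit disk.\<close>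

locale slit_potential =
  fixes F h :: "complex \<Rightarrow> complex" and \<Phi> :: "real \<Rightarrow> complex"
  assumes F_deriv: "z \<in> slit_plane \<Longrightarrow> (F has_field_derivative h z) (at z)"
    and h_bound: "z \<in> slit_plane \<Longrightarrow> norm (h z) \<le> 1/100"
    and \<Phi>_cont: "continuous_on UNIV \<Phi>"
    and \<Phi>_top: "(\<Phi> \<longlongrightarrow> 1) at_top" and \<Phi>_bot: "(\<Phi> \<longlongrightarrow> -1) at_bot"
    and \<Phi>_Im: "Im (\<Phi> t) < 0"
    and \<Phi>_zero: "Re (F (\<Phi> t)) = (norm (\<Phi> t))\<^sup>2 / 4"
    and \<Phi>_grad: "norm (h (\<Phi> t) - cnj (\<Phi> t) / 2) = 1/2"
begin

text \<open>The default 0 off the slit plane is the correct boundary value at 1 and -1, the only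
  points of the slits that the closure of \<open>Om\<close> reaches.\<close>

definition u :: "complex \<Rightarrow> real" where
  "u z = (if z \<in> slit_plane then Re (F z) - (norm z)\<^sup>2 / 4 else 0)"

definition Om :: "complex set" where
  "Om = {z \<in> slit_plane. u z > 0}"

section \<open>Bounds for the potential from the smallness of \<open>h\<close>\<close>

lemma \<Phi>_slit: "\<Phi> t \<in> slit_plane"
  using \<Phi>_Im[of t] by (auto simp: slit_plane_def)

text \<open>The slit plane is not convex, so the derivative bound is integrated along one segment,
  which stays in the slit plane because \<open>x\<close> is a star centre.\<close>

lemma F_lipschitz:
  assumes z: "z \<in> slit_plane" and x: "\<bar>x\<bar> < 1"
  shows "norm (F z - F (of_real x)) \<le> 1/100 * norm (z - of_real x)"
proof (rule field_differentiable_bound)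
  show "convex (closed_segment (complex_of_real x) z)" by simp
qed (use closed_segment_slit_plane[OF z x] F_deriv h_bound in
     \<open>auto intro: has_field_derivative_at_within\<close>)

text \<open>Near an endpoint of the slits the plane is not convex, so the Lipschitz bound is routed
  through points \<open>x\<close> of the real segment with \<open>x\<close> tending to that endpoint.\<close>

lemma F_near_end:
  assumes z: "z \<in> slit_plane" and e: "\<bar>e\<bar> = 1"
    and G: "G \<noteq> bot" "(\<Phi> \<longlongrightarrow> of_real e) G"
  shows "\<bar>Re (F z) - 1/4\<bar> \<le> 1/100 * norm (z - of_real e)"
proof -
  have 1: "\<bar>Re (F z) - (norm (\<Phi> t))\<^sup>2 / 4\<bar> \<le> 1/100 * (norm (z - of_real e) + norm (\<Phi> t - of_real e))" for t
  proof -
    let ?x = "\<lambda>r. e * r"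
    have le: "norm (F z - F (\<Phi> t)) \<le> 1/100 * (norm (z - of_real (e * r)) + norm (\<Phi> t - of_real (e * r)))"
      if "r \<in> {0<..<1}" for r
    proof -
      have "\<bar>e * r\<bar> < 1" using e that by (simp add: abs_mult)
      from F_lipschitz[OF z this] F_lipschitz[OF \<Phi>_slit[of t] this]
      show ?thesis
        using norm_triangle_ineq4[of "F z - F (of_real (e * r))" "F (\<Phi> t) - F (of_real (e * r))"]
        by simp
    qed
    have ev: "\<forall>\<^sub>F r in at_left (1::real). norm (F z - F (\<Phi> t)) \<le>
        1/100 * (norm (z - of_real (e * r)) + norm (\<Phi> t - of_real (e * r)))"
      by (rule eventually_mono[OF eventually_at_left_real[of 0 1]]) (simp_all only: le zero_less_one)
    have lim: "((\<lambda>r. 1/100 * (norm (z - of_real (e * r)) + norm (\<Phi> t - of_real (e * r)))) \<longlongrightarrow>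
        1/100 * (norm (z - of_real (e * 1)) + norm (\<Phi> t - of_real (e * 1)))) (at_left (1::real))"
      by (intro tendsto_intros)
    have "norm (F z - F (\<Phi> t)) \<le> 1/100 * (norm (z - of_real e) + norm (\<Phi> t - of_real e))"
      using tendsto_lowerbound[OF lim ev] by simp
    moreover have "\<bar>Re (F z) - (norm (\<Phi> t))\<^sup>2 / 4\<bar> \<le> norm (F z - F (\<Phi> t))"
      using abs_Re_le_cmod[of "F z - F (\<Phi> t)"] \<Phi>_zero[of t] by simp
    ultimately show ?thesis by simp
  qed
  \<comment> \<open>Now \<open>t\<close> runs to the end of the arc: there \<open>\<Phi> t\<close>
    tends to \<open>e\<close>, of modulus 1, which produces the value 1/4.\<close>
  have l1: "((\<lambda>t. \<bar>Re (F z) - (norm (\<Phi> t))\<^sup>2 / 4\<bar>) \<longlongrightarrow> \<bar>Re (F z) - (norm (complex_of_real e))\<^sup>2 / 4\<bar>) G"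
    by (intro tendsto_intros G) auto
  have l2: "((\<lambda>t. 1/100 * (norm (z - of_real e) + norm (\<Phi> t - of_real e))) \<longlongrightarrow>
      1/100 * (norm (z - of_real e) + norm (complex_of_real e - of_real e))) G"
    by (intro tendsto_intros G)
  have "\<bar>Re (F z) - (norm (complex_of_real e))\<^sup>2 / 4\<bar> \<le>
      1/100 * (norm (z - of_real e) + norm (complex_of_real e - of_real e))"
    by (rule tendsto_le[OF G(1) l2 l1]) (use 1 in auto)
  then show ?thesis using e by simp
qed

lemma F_near_one:
  assumes "z \<in> slit_plane" "e \<in> {1, -1}"
  shows "\<bar>Re (F z) - 1/4\<bar> \<le> 1/100 * norm (z - of_real e)"
  using assms F_near_end[OF assms(1), of 1 at_top] F_near_end[OF assms(1), of "-1" at_bot]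
    \<Phi>_top \<Phi>_bot by auto

text \<open>These compare \<open>u\<close> with the disk solution. Either tip may be chosen as
  \<open>e\<close>, and later arguments take the nearer one to make the error vanish at that
  tip.\<close>

lemma u_bounds:
  assumes "z \<in> slit_plane" "e \<in> {1, -1}"
  shows "u z \<le> 1/4 + 1/100 * norm (z - of_real e) - (norm z)\<^sup>2 / 4"
    and "u z \<ge> 1/4 - 1/100 * norm (z - of_real e) - (norm z)\<^sup>2 / 4"
  using F_near_one[OF assms, unfolded abs_le_iff] assms(1) by (simp_all add: u_def)

text \<open>For modulus at least 2 the quadratic term beats the linear error. The radius 2 is
  matched by the scaling factor 2 of the final transfer.\<close>

lemma Om_norm_less:
  assumes "z \<in> Om"
  shows "norm z < 2"
proof (rule ccontr)
  assume "\<not> norm z < 2"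
  then have n: "norm z \<ge> 2" by simp
  have "u z \<le> 1/4 + 1/100 * norm (z - 1) - (norm z)\<^sup>2 / 4"
    using u_bounds(1)[of z 1] assms by (auto simp: Om_def)
  moreover have "norm (z - 1) \<le> norm z + 1"
    using norm_triangle_ineq4[of z 1] by simp
  moreover have "(norm z)\<^sup>2 \<ge> 2 * norm z"
    using n by (simp add: power2_eq_square mult_right_mono)
  ultimately have "u z \<le> 1/4 + 1/100 * (norm z + 1) - 2 * norm z / 4" by argo
  moreover have "u z > 0" using assms by (simp add: Om_def)
  ultimately show False using n by argo
qed

section \<open>Regularity and radial decay of \<open>u\<close>\<close>

lemma F_cont: "continuous_on slit_plane F"
  using F_deriv by (auto intro!: continuous_at_imp_continuous_on DERIV_isCont)

lemma u_cont: "continuous_on slit_plane u"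
proof -
  have "continuous_on slit_plane (\<lambda>z. Re (F z) - (norm z)\<^sup>2 / 4)"
    by (intro continuous_intros F_cont) auto
  then show ?thesis
    by (simp add: u_def cong: continuous_on_cong)
qed

lemma u_has_derivative:
  assumes "z \<in> slit_plane"
  shows "(u has_derivative (\<lambda>v. Re ((h z - cnj z / 2) * v))) (at z)"
proof -
  have "(F has_derivative (\<lambda>v. h z * v)) (at z)"
    using F_deriv[OF assms] by (simp add: has_field_derivative_def)
  then have "((\<lambda>w. Re (F w) - (w \<bullet> w) / 4) has_derivative
      (\<lambda>v. Re (h z * v) - (z \<bullet> v + v \<bullet> z) / 4)) (at z)"
    by (auto intro!: derivative_eq_intros)
  also have "(\<lambda>v. Re (h z * v) - (z \<bullet> v + v \<bullet> z) / 4) = (\<lambda>v. Re ((h z - cnj z / 2) * v))"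
    by (auto simp: inner_complex_def algebra_simps)
  finally have *: "((\<lambda>w. Re (F w) - (w \<bullet> w) / 4) has_derivative (\<lambda>v. Re ((h z - cnj z / 2) * v))) (at z)" .
  show ?thesis
    by (rule has_derivative_transform_within_open[OF * open_slit_plane assms])
       (auto simp: u_def power2_norm_eq_inner)
qed

lemma u_ray_deriv:
  assumes "r *\<^sub>R z \<in> slit_plane"
  shows "((\<lambda>r. u (r *\<^sub>R z)) has_real_derivative (Re (h (r *\<^sub>R z) * z) - r * (norm z)\<^sup>2 / 2)) (at r)"
proof -
  have "((\<lambda>r. r *\<^sub>R z) has_derivative (\<lambda>t. t *\<^sub>R z)) (at r)"
    by (auto intro!: derivative_eq_intros)
  from has_derivative_compose[OF this u_has_derivative[OF assms]]
  have "((\<lambda>r. u (r *\<^sub>R z)) has_derivative (\<lambda>t. Re ((h (r *\<^sub>R z) - cnj (r *\<^sub>R z) / 2) * (t *\<^sub>R z)))) (at r)" .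
  also have "(\<lambda>t. Re ((h (r *\<^sub>R z) - cnj (r *\<^sub>R z) / 2) * (t *\<^sub>R z))) =
     (*) (Re (h (r *\<^sub>R z) * z) - r * (norm z)\<^sup>2 / 2)"
    unfolding cmod_power2 by (auto simp: field_simps power2_eq_square)
  finally show ?thesis by (simp add: has_field_derivative_def)
qed

text \<open>Two regimes: within distance 1/2 of the centre the lower bound of
  \<open>u_bounds\<close> is positive. Farther out the radial derivative is negative, the term from
  the square of the modulus outweighing \<open>h\<close>, so moving inwards strictly increases
  \<open>u\<close>.\<close>

lemma u_ray_pos:
  assumes z: "z \<in> slit_plane" "u z \<ge> 0" and r: "0 \<le> r" "r < 1"
  shows "u (r *\<^sub>R z) > 0"
proof (cases "norm (r *\<^sub>R z) \<le> 1/2")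
  case True
  have "u (r *\<^sub>R z) \<ge> 1/4 - 1/100 * norm (r *\<^sub>R z - 1) - (norm (r *\<^sub>R z))\<^sup>2 / 4"
    using u_bounds(2)[OF scaleR_slit_plane[OF z(1) r(1)], of 1] r by simp
  moreover have "norm (r *\<^sub>R z - 1) \<le> 3/2"
    using norm_triangle_ineq4[of "r *\<^sub>R z" 1] True by simp
  moreover have "(norm (r *\<^sub>R z))\<^sup>2 \<le> (1/2)\<^sup>2"
    by (rule power_mono) (use True in auto)
  ultimately show ?thesis by (simp add: power2_eq_square)
next
  case False
  have nz: "norm z > 0" using False by auto
  have "u (r *\<^sub>R z) > u (1 *\<^sub>R z)"
  proof (rule DERIV_neg_imp_decreasing[OF r(2)])
    fix x assume x: "r \<le> x" "x \<le> 1"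
    have xs: "x *\<^sub>R z \<in> slit_plane" using scaleR_slit_plane[OF z(1)] r x by simp
    have "Re (h (x *\<^sub>R z) * z) \<le> norm (h (x *\<^sub>R z)) * norm z"
      using complex_Re_le_cmod[of "h (x *\<^sub>R z) * z"] by (simp add: norm_mult)
    also have "\<dots> \<le> 1/100 * norm z"
      using h_bound[OF xs] by (intro mult_right_mono) auto
    finally have "Re (h (x *\<^sub>R z) * z) - x * (norm z)\<^sup>2 / 2 \<le> norm z * (1/100 - (x * norm z) / 2)"
      by (simp add: algebra_simps power2_eq_square)
    also have "x * norm z > 1/2"
    proof -
      have "1/2 < r * norm z" using False r by simp
      also have "\<dots> \<le> x * norm z" using x by (intro mult_right_mono) auto
      finally show ?thesis .
    qed
    then have "norm z * (1/100 - (x * norm z) / 2) < 0"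
      using nz by (intro mult_pos_neg) auto
    finally have "Re (h (x *\<^sub>R z) * z) - x * (norm z)\<^sup>2 / 2 < 0" .
    then show "\<exists>y. ((\<lambda>r. u (r *\<^sub>R z)) has_real_derivative y) (at x) \<and> y < 0"
      using u_ray_deriv[OF xs] by blast
  qed
  then show ?thesis using z by simp
qed

section \<open>The domain \<open>Om\<close>, its closure and its frontier\<close>

lemma zero_in_slit: "0 \<in> slit_plane" by (simp add: slit_plane_def)

lemma zero_in_Om: "0 \<in> Om"
  using u_bounds(2)[OF zero_in_slit, of 1] by (simp add: Om_def zero_in_slit)

lemma open_Om: "open Om"
proof -
  have "Om = slit_plane \<inter> u -` {0<..}" by (auto simp: Om_def)
  then show ?thesis
    using continuous_open_preimage[OF u_cont open_slit_plane, of "{0<..}"] by simp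
qed

lemma starlike_Om: "closed_segment 0 z \<subseteq> Om" if "z \<in> Om"
proof
  fix w assume "w \<in> closed_segment 0 z"
  then obtain r where r: "0 \<le> r" "r \<le> 1" "w = r *\<^sub>R z"
    by (auto simp: in_segment)
  show "w \<in> Om"
    using that r u_ray_pos[of z r] scaleR_slit_plane[of z r]
    by (cases "r = 1") (auto simp: Om_def)
qed

text \<open>Off the slits this is continuity of \<open>u\<close>. A limit point \<open>a\<close> on
  a slit inherits the upper bound of \<open>u_bounds\<close>; taking the tip of the same sign leaves
  \<open>(|a| - 1) * (|a| + 1 - 4/100) \<le> 0\<close>, so \<open>a\<close> is that tip.\<close>

lemma closure_Om: "closure Om \<subseteq> {z \<in> slit_plane. u z \<ge> 0} \<union> {1, -1}"
proof
  fix z assume "z \<in> closure Om"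
  then obtain x where x: "\<And>n. x n \<in> Om" and lim: "x \<longlonglongrightarrow> z"
    by (auto simp: closure_sequential)
  have xs: "x n \<in> slit_plane" and xu: "u (x n) > 0" for n
    using x by (auto simp: Om_def)
  show "z \<in> {z \<in> slit_plane. u z \<ge> 0} \<union> {1, -1}"
  proof (cases "z \<in> slit_plane")
    case True
    then have "isCont u z"
      using u_cont open_slit_plane continuous_on_eq_continuous_at by blast
    then have "(\<lambda>n. u (x n)) \<longlonglongrightarrow> u z"
      using lim by (rule isCont_tendsto_compose)
    then have "u z \<ge> 0"
      by (rule LIMSEQ_le_const) (use xu less_imp_le in blast)
    then show ?thesis using True by simp
  next
    case False
    then have z: "Im z = 0" "\<bar>Re z\<bar> \<ge> 1" by (auto simp: slit_plane_def)
    have b: "(norm z)\<^sup>2 / 4 \<le> 1/4 + 1/100 * norm (z - of_real e)" if e: "e \<in> {1, -1}" for e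
    proof (rule LIMSEQ_le)
      show "(\<lambda>n. (norm (x n))\<^sup>2 / 4) \<longlonglongrightarrow> (norm z)\<^sup>2 / 4"
        by (intro tendsto_intros lim) auto
      show "(\<lambda>n. 1/4 + 1/100 * norm (x n - of_real e)) \<longlonglongrightarrow> 1/4 + 1/100 * norm (z - of_real e)"
        by (intro tendsto_intros lim)
      show "\<exists>N. \<forall>n\<ge>N. (norm (x n))\<^sup>2 / 4 \<le> 1/4 + 1/100 * norm (x n - of_real e)"
        using u_bounds(1)[OF xs e] xu by (smt (verit))
    qed
    obtain a where a: "z = of_real a" using z(1) by (metis complex_is_Real_iff Reals_cases)
    have aa: "a * a \<le> 1 + 4/100 * norm (complex_of_real a - of_real e)" if "e \<in> {1, -1}" for e
      using b[OF that] unfolding a by (simp add: power2_eq_square)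
    have "a = 1 \<or> a = -1"
    proof (cases "a > 0")
      case True
      have "norm (complex_of_real a - of_real 1) = a - 1"
        using z True unfolding of_real_diff[symmetric] norm_of_real a by simp
      then have "a * a \<le> 1 + 4/100 * (a - 1)"
        using aa[of 1] by simp
      then have "(a - 1) * (a + 1 - 4/100) \<le> 0" by (simp add: field_simps)
      then show ?thesis using True z a by (auto simp: mult_le_0_iff)
    next
      case False
      have "norm (complex_of_real a - of_real (-1)) = - a - 1"
        using z False unfolding of_real_diff[symmetric] norm_of_real a by simp
      then have "a * a \<le> 1 + 4/100 * (- a - 1)"
        using aa[of "-1"] by simp
      then have "(a + 1) * (a - 1 + 4/100) \<le> 0" by (simp add: field_simps)
      then show ?thesis using False z a by (auto simp: mult_le_0_iff)
    qed
    then show ?thesis using a by auto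
  qed
qed

lemma one_notin_slit: "e \<in> {1, -1} \<Longrightarrow> of_real e \<notin> slit_plane"
  by (auto simp: slit_plane_def)

text \<open>On the real radius towards \<open>e\<close> the lower bound for \<open>u\<close> factors
  as \<open>1 - r\<close> times a positive number, so the whole open radius lies in
  \<open>Om\<close>.\<close>

lemma ends_in_closure:
  assumes "e \<in> {1, -1::real}"
  shows "of_real e \<in> closure Om"
proof (rule ray_in_closure)
    fix r :: real assume r: "r \<in> {0<..<1}"
    have s: "r *\<^sub>R complex_of_real e \<in> slit_plane"
      using r assms by (auto simp: slit_plane_def)
    have "norm (r *\<^sub>R complex_of_real e - of_real e) = norm ((r - 1) *\<^sub>R complex_of_real e)"
      by (simp add: algebra_simps)
    also have "\<dots> = 1 - r" using r assms by auto
    finally have "u (r *\<^sub>R complex_of_real e) \<ge> 1/4 - 1/100 * (1 - r) - r\<^sup>2 / 4"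
      using u_bounds(2)[OF s assms] r assms by (auto simp: norm_mult)
    moreover have "1/4 - 1/100 * (1 - r) - r\<^sup>2 / 4 = (1 - r) * ((1 + r) / 4 - 1/100)"
      by (simp add: field_simps power2_eq_square)
    moreover have "\<dots> > 0" using r by (intro mult_pos_pos) auto
    ultimately show "r *\<^sub>R complex_of_real e \<in> Om"
      using s by (simp add: Om_def)
qed

text \<open>A zero \<open>z\<close> of \<open>u\<close> is the limit of the points
  \<open>r *\<^sub>R z\<close> with \<open>r < 1\<close>, and these lie in \<open>Om\<close> by
  \<open>u_ray_pos\<close>.\<close>

lemma frontier_Om: "frontier Om = {z \<in> slit_plane. u z = 0} \<union> {1, -1}"
proof
  show "frontier Om \<subseteq> {z \<in> slit_plane. u z = 0} \<union> {1, -1}"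
    using closure_Om unfolding frontier_def interior_open[OF open_Om] by (fastforce simp: Om_def)
  have "z \<in> closure Om" if z: "z \<in> slit_plane" "u z = 0" for z
  proof (rule ray_in_closure)
    fix r :: real assume "r \<in> {0<..<1}"
    then show "r *\<^sub>R z \<in> Om"
      using u_ray_pos[of z r] scaleR_slit_plane[of z r] z by (auto simp: Om_def)
  qed
  then show "{z \<in> slit_plane. u z = 0} \<union> {1, -1} \<subseteq> frontier Om"
    using ends_in_closure[of 1] ends_in_closure[of "-1"] one_notin_slit[of 1] one_notin_slit[of "-1"]
    unfolding frontier_def interior_open[OF open_Om] by (auto simp: Om_def)
qed

section \<open>The arc as the lower part of the frontier\<close>

lemma u_\<Phi>: "u (\<Phi> t) = 0"
  using \<Phi>_slit[of t] \<Phi>_zero[of t] by (simp add: u_def)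

text \<open>By \<open>u_ray_pos\<close> the nearer of two distinct zeros on a ray would have a
  positive value.\<close>

lemma u_zero_unique_on_ray:
  assumes "z \<in> slit_plane" "u z = 0" "r > 0" "r *\<^sub>R z \<in> slit_plane" "u (r *\<^sub>R z) = 0"
  shows "r = 1"
proof (rule ccontr)
  assume "r \<noteq> 1"
  then consider "r < 1" | "1 < r" by linarith
  then show False
  proof cases
    case 1
    then show ?thesis using u_ray_pos[of z r] assms by simp
  next
    case 2
    then show ?thesis using u_ray_pos[of "r *\<^sub>R z" "1/r"] assms by simp
  qed
qed

text \<open>The arc runs from -1 to 1 in the lower half-plane, so by the intermediate value theorem
  it crosses every ray there; each ray carries only one frontier point.\<close>

lemma range_\<Phi>: "range \<Phi> = frontier Om \<inter> {z. Im z < 0}"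
proof
  show "range \<Phi> \<subseteq> frontier Om \<inter> {z. Im z < 0}"
    using u_\<Phi> \<Phi>_slit \<Phi>_Im by (auto simp: frontier_Om)
  show "frontier Om \<inter> {z. Im z < 0} \<subseteq> range \<Phi>"
  proof
    fix p assume "p \<in> frontier Om \<inter> {z. Im z < 0}"
    then have p: "p \<in> slit_plane" "u p = 0" "Im p < 0"
      by (auto simp: frontier_Om)
    \<comment> \<open>\<open>c t\<close> is the cross product of \<open>\<Phi> t\<close> and
      \<open>p\<close>; a zero means that they are parallel, and since both lie below the real axis
      the ratio is positive.\<close>
    define c where "c t = Re (\<Phi> t) * Im p - Im (\<Phi> t) * Re p" for t
    have cont: "continuous_on UNIV c"
      unfolding c_def by (intro continuous_intros \<Phi>_cont)
    have "(c \<longlongrightarrow> Re 1 * Im p - Im 1 * Re p) at_top" "(c \<longlongrightarrow> Re (-1) * Im p - Im (-1) * Re p) at_bot"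
      unfolding c_def by (intro tendsto_intros \<Phi>_top \<Phi>_bot)+
    then have "\<forall>\<^sub>F t in at_top. c t < 0" "\<forall>\<^sub>F t in at_bot. c t > 0"
      using p(3) order_tendstoD(2)[of c "Im p" at_top 0] order_tendstoD(1)[of c "- Im p" at_bot 0]
      by simp_all
    then obtain a b where ab: "c a < 0" "c b > 0"
      by (meson eventually_happens trivial_limit_at_top_linorder trivial_limit_at_bot_linorder)
    have "connected (range c)"
      using cont connected_UNIV connected_continuous_image by blast
    then have "0 \<in> range c"
      using ab unfolding connected_iff_interval by (meson less_imp_le rangeI)
    then obtain t where t: "c t = 0" by auto
    define r where "r = Im (\<Phi> t) / Im p"
    have r: "r > 0" using \<Phi>_Im p(3) by (simp add: r_def divide_neg_neg)
    have "\<Phi> t = r *\<^sub>R p"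
      using t p(3) by (auto simp: r_def c_def complex_eq_iff field_simps)
    then have "r = 1"
      using u_zero_unique_on_ray[of p r] p r \<Phi>_slit[of t] u_\<Phi>[of t] by simp
    then show "p \<in> range \<Phi>" using \<open>\<Phi> t = r *\<^sub>R p\<close> by (metis rangeI scaleR_one)
  qed
qed

section \<open>Continuity of \<open>u\<close> up to the boundary\<close>

lemma u_tendsto_end:
  assumes "e \<in> {1, -1::real}"
  shows "(u \<longlongrightarrow> 0) (at (of_real e) within slit_plane)"
proof (rule tendsto_sandwich)
  let ?G = "at (complex_of_real e) within slit_plane"
  show "\<forall>\<^sub>F z in ?G. 1/4 - 1/100 * norm (z - of_real e) - (norm z)\<^sup>2 / 4 \<le> u z"
    using u_bounds(2)[OF _ assms] by (auto simp: eventually_at_filter)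
  show "\<forall>\<^sub>F z in ?G. u z \<le> 1/4 + 1/100 * norm (z - of_real e) - (norm z)\<^sup>2 / 4"
    using u_bounds(1)[OF _ assms] by (auto simp: eventually_at_filter)
  have "((\<lambda>z. 1/4 - 1/100 * norm (z - of_real e) - (norm z)\<^sup>2 / 4) \<longlongrightarrow>
      1/4 - 1/100 * norm (of_real e - complex_of_real e) - (norm (complex_of_real e))\<^sup>2 / 4) ?G"
    by (intro tendsto_intros) auto
  then show "((\<lambda>z. 1/4 - 1/100 * norm (z - of_real e) - (norm z)\<^sup>2 / 4) \<longlongrightarrow> 0) ?G"
    using assms by auto
  have "((\<lambda>z. 1/4 + 1/100 * norm (z - of_real e) - (norm z)\<^sup>2 / 4) \<longlongrightarrow>
      1/4 + 1/100 * norm (of_real e - complex_of_real e) - (norm (complex_of_real e))\<^sup>2 / 4) ?G"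
    by (intro tendsto_intros) auto
  then show "((\<lambda>z. 1/4 + 1/100 * norm (z - of_real e) - (norm z)\<^sup>2 / 4) \<longlongrightarrow> 0) ?G"
    using assms by auto
qed

text \<open>Only the tips need an argument: near a tip, all other points of the closure lie in the
  slit plane, where \<open>u_bounds\<close> squeezes \<open>u\<close> to the default value
  0.\<close>

lemma u_cont_closure: "continuous_on (closure Om) u"
  unfolding continuous_on_def
proof
  fix z assume z: "z \<in> closure Om"
  show "(u \<longlongrightarrow> u z) (at z within closure Om)"
  proof (cases "z \<in> slit_plane")
    case True
    then have "isCont u z"
      using u_cont open_slit_plane continuous_on_eq_continuous_at by blast
    then show ?thesis unfolding isCont_def by (rule tendsto_within_subset) simp
  next
    case False
    then have "z = of_real 1 \<or> z = of_real (-1)"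
      using z closure_Om by auto
    then obtain e where e: "e \<in> {1, -1::real}" "z = of_real e"
      by blast
    have "open (- ({1, -1} - {z}))"
      by (intro open_Compl finite_imp_closed) simp
    then have "\<forall>\<^sub>F w in at z. w \<in> - ({1, -1} - {z})"
      by (rule eventually_at_in_open') simp
    then have ev: "\<forall>\<^sub>F w in at z within closure Om. w \<in> slit_plane"
      unfolding eventually_at_filter by (rule eventually_mono) (use closure_Om in blast)
    have "(u \<longlongrightarrow> 0) (at z within closure Om \<inter> slit_plane)"
      using u_tendsto_end[OF e(1)] unfolding e(2) by (rule tendsto_within_subset) simp
    moreover have "at z within closure Om \<inter> slit_plane = at z within closure Om"
      using ev by (auto simp: filter_eq_iff eventually_at_filter elim: eventually_elim2)
    ultimately have "(u \<longlongrightarrow> 0) (at z within closure Om)" by simp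
    then show ?thesis using False by (simp add: u_def)
  qed
qed

end

section \<open>The perturbed strip\<close>

lemma pi_half_less: "pi / 2 < 19/10"
  using pi_approx by simp

text \<open>The width 2 leaves a margin beyond \<open>pi / 2\<close>, the half-width of the image of
  \<open>artanh\<close>. The factor \<open>min 1 (norm s)\<close> keeps \<open>k\<close> small
  everywhere and, in the bound on the derivative, gives \<open>k\<close> a double zero at 0. By
  \<open>k_refl\<close> the edge \<open>Im s = - pi / 4\<close> becomes a graph of height
  \<open>\<kappa> x - pi / 4\<close>.\<close>

locale strip_perturbation =
  fixes k :: "complex \<Rightarrow> complex" and \<kappa> :: "real \<Rightarrow> real"
  assumes k_hol: "k holomorphic_on {s. \<bar>Im s\<bar> < 2}"
    and k_bound: "\<bar>Im s\<bar> < 2 \<Longrightarrow> norm (k s) \<le> min 1 (norm s) / 5000"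
    and k_deriv_bound: "\<bar>Im s\<bar> < 2 \<Longrightarrow> norm (deriv k s) \<le> min 1 (norm s) / 5000"
    and k_refl: "k (of_real x - \<i> * (pi / 4)) = \<i> * of_real (\<kappa> x)"
begin

abbreviation "\<Sigma> \<equiv> {s::complex. \<bar>Im s\<bar> < 2}"

definition E :: "complex \<Rightarrow> complex" where "E s = s + k s"

section \<open>Inverting the perturbed strip coordinate\<close>

lemma k_deriv: "s \<in> \<Sigma> \<Longrightarrow> (k has_field_derivative deriv k s) (at s)"
  using k_hol open_Im_strip holomorphic_derivI by blast

lemma k_lipschitz:
  assumes "a \<in> \<Sigma>" "b \<in> \<Sigma>"
  shows "norm (k a - k b) \<le> 1/5000 * norm (a - b)"
proof (rule field_differentiable_bound[OF convex_Im_strip])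
  fix z assume "z \<in> \<Sigma>"
  then show "(k has_field_derivative deriv k z) (at z within \<Sigma>)" "norm (deriv k z) \<le> 1/5000"
    using k_deriv[of z] k_deriv_bound[of z] by (auto intro: has_field_derivative_at_within)
qed (use assms in auto)

lemma inj_E: "inj_on E \<Sigma>"
proof (rule inj_onI)
  fix a b assume ab: "a \<in> \<Sigma>" "b \<in> \<Sigma>" "E a = E b"
  then have "a - b = k b - k a" by (simp add: E_def algebra_simps)
  then have "norm (a - b) \<le> 1/5000 * norm (a - b)"
    using k_lipschitz[OF ab(1,2)] by (simp add: norm_minus_commute)
  then show "a = b" by simp
qed

lemma k_le: "s \<in> \<Sigma> \<Longrightarrow> norm (k s) \<le> 1/5000"
  using k_bound[of s] by simp

text \<open>Solving \<open>v = s + k s\<close> means finding a fixed point of the contraction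
  \<open>s \<mapsto> v - k s\<close>.\<close>

lemma E_surj:
  assumes "\<bar>Im v\<bar> < pi / 2"
  shows "v \<in> E ` \<Sigma>"
proof -
  \<comment> \<open>The margin 1/5000 is the bound on \<open>k\<close>, so the closed strip is
    mapped into itself, and it still fits inside \<open>\<Sigma>\<close>.\<close>
  let ?S = "{s. \<bar>Im s\<bar> \<le> pi / 2 + 1/5000}"
  have sub: "?S \<subseteq> \<Sigma>" using pi_half_less by auto
  have S_eq: "?S = {s. Im s \<le> pi / 2 + 1/5000} \<inter> {s. Im s \<ge> - (pi / 2 + 1/5000)}" by auto
  have "closed ?S"
    unfolding S_eq by (intro closed_Int closed_halfspace_Im_le closed_halfspace_Im_ge)
  then have "complete ?S" by (simp add: complete_eq_closed)
  then have "\<exists>!s\<in>?S. v - k s = s"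
  proof (rule Banach_fix[where c = "1/5000"])
    show "?S \<noteq> {}" by (auto intro!: exI[of _ 0])
    show "(\<lambda>s. v - k s) ` ?S \<subseteq> ?S"
    proof clarsimp
      fix s assume s: "\<bar>Im s\<bar> \<le> pi / 2 + 1/5000"
      then have "\<bar>Im (k s)\<bar> \<le> 1/5000"
        using k_le[of s] sub abs_Im_le_cmod[of "k s"] by fastforce
      then show "\<bar>Im v - Im (k s)\<bar> \<le> pi / 2 + 1/5000" using assms by linarith
    qed
    fix x y assume "x \<in> ?S" "y \<in> ?S"
    then have "norm (k y - k x) \<le> 1/5000 * norm (y - x)"
      using sub by (intro k_lipschitz) auto
    then show "dist (v - k x) (v - k y) \<le> 1/5000 * dist x y"
      by (simp add: dist_norm norm_minus_commute)
  qed auto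
  then obtain s where "s \<in> \<Sigma>" "v - k s = s" using sub by auto
  then show ?thesis by (intro image_eqI[of _ _ s]) (auto simp: E_def algebra_simps)
qed

text \<open>This is the strip coordinate of \<open>z\<close>, inverse to
  \<open>s \<mapsto> tanh (s + k s)\<close>. It is not the Schwarz function, which is
  \<open>coth (W z)\<close> with the \<open>W\<close> defined below.\<close>

definition S :: "complex \<Rightarrow> complex" where
  "S z = inv_into \<Sigma> E (artanh z)"

lemma S_in: assumes "z \<in> slit_plane" shows "S z \<in> \<Sigma>"
  unfolding S_def by (rule inv_into_into[OF E_surj[OF abs_Im_artanh[OF assms]]])

lemma E_S: assumes "z \<in> slit_plane" shows "E (S z) = artanh z"
  unfolding S_def by (rule f_inv_into_f[OF E_surj[OF abs_Im_artanh[OF assms]]])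

lemma S_hol: "S holomorphic_on slit_plane"
proof -
  have "E holomorphic_on \<Sigma>"
    unfolding E_def by (intro holomorphic_intros k_hol)
  then obtain g where g: "g holomorphic_on (E ` \<Sigma>)" "\<And>s. s \<in> \<Sigma> \<Longrightarrow> g (E s) = s"
    using holomorphic_has_inverse[OF _ open_Im_strip inj_E] by metis
  have "g \<circ> artanh holomorphic_on slit_plane"
    by (rule holomorphic_on_compose_gen[OF holomorphic_on_artanh g(1)])
       (use E_surj abs_Im_artanh in auto)
  then show ?thesis
    by (rule holomorphic_transform) (metis E_S S_in comp_apply g(2))
qed

lemma k_0: "k 0 = 0" using k_bound[of 0] by simp

text \<open>This locates the pole of the Schwarz function: \<open>W\<close> vanishes only where
  \<open>S\<close> does, hence only at the centre.\<close>

lemma S_0_iff: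
  assumes "z \<in> slit_plane"
  shows "S z = 0 \<longleftrightarrow> z = 0"
proof
  assume "S z = 0"
  then have "artanh z = 0" using E_S[OF assms] by (simp add: E_def k_0)
  then show "z = 0"
    using tanh_artanh_complex[of z] slit_plane_cayley[OF assms] by simp
next
  assume "z = 0"
  then have "E (S z) = E 0" using E_S[OF assms] by (simp add: E_def k_0)
  then show "S z = 0" using inj_E S_in[OF assms] by (auto dest: inj_onD)
qed

section \<open>The holomorphic derivative of the potential\<close>

definition W :: "complex \<Rightarrow> complex" where "W z = S z - k (S z)"
text \<open>Differentiating \<open>coth (s - k s)\<close> with respect to
  \<open>tanh (s + k s)\<close> shows that the conjugate normal is
  \<open>m s * cosh (E s) / sinh (s - k s)\<close>.\<close>

definition m :: "complex \<Rightarrow> complex" where "m s = csqrt ((1 - deriv k s) / (1 + deriv k s))"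
text \<open>Half the Schwarz function minus the conjugate normal, with \<open>cosh (E s)\<close>
  expanded through \<open>E s = W z + 2 * k s\<close> for \<open>s = S z\<close>. The expansion
  isolates the factor \<open>1 - m * cosh (2 * k)\<close>, which vanishes at the centre and cancels
  the pole of coth.\<close>

definition h0 :: "complex \<Rightarrow> complex" where
  "h0 z = ((1 - m (S z) * cosh (2 * k (S z))) * (cosh (W z) / sinh (W z)) - m (S z) * sinh (2 * k (S z))) / 2"

text \<open>Since \<open>W z = artanh z - 2 * k (S z)\<close>, its imaginary part barely exceeds
  \<open>pi / 2\<close>. The bound 2 is below \<open>pi\<close>, so 0 is the only zero of sinh that
  matters; the second bound controls the size of the pole.\<close>

lemma W_bounds:
  assumes "z \<in> slit_plane"
  shows "\<bar>Im (W z)\<bar> \<le> 2" "norm (S z) / 2 \<le> norm (W z)"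
proof -
  have "W z = artanh z - 2 * k (S z)"
    using E_S[OF assms] by (simp add: W_def E_def algebra_simps)
  moreover have "\<bar>Im (k (S z))\<bar> \<le> 1/5000"
    using k_le[OF S_in[OF assms]] abs_Im_le_cmod[of "k (S z)"] by linarith
  ultimately show "\<bar>Im (W z)\<bar> \<le> 2"
    using abs_Im_artanh[OF assms] pi_half_less by simp
  have "norm (k (S z)) \<le> norm (S z) / 5000"
    using k_bound[of "S z"] S_in[OF assms] by simp
  then show "norm (S z) / 2 \<le> norm (W z)"
    unfolding W_def using norm_triangle_ineq2[of "S z" "k (S z)"] norm_ge_zero[of "S z"] by linarith
qed

lemma deriv_k_small: "s \<in> \<Sigma> \<Longrightarrow> norm (deriv k s) \<le> 1/5000"
  using k_deriv_bound[of s] by simp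

lemma one_plus_deriv_k: "s \<in> \<Sigma> \<Longrightarrow> norm (1 + deriv k s) \<ge> 1/2" "s \<in> \<Sigma> \<Longrightarrow> 1 + deriv k s \<noteq> 0"
proof -
  assume "s \<in> \<Sigma>"
  then show "norm (1 + deriv k s) \<ge> 1/2"
    using deriv_k_small[of s] norm_diff_ineq[of 1 "deriv k s"] by simp
  then show "1 + deriv k s \<noteq> 0" by auto
qed

lemma m_arg:
  assumes "s \<in> \<Sigma>"
  shows "norm ((1 - deriv k s) / (1 + deriv k s) - 1) \<le> 4 * norm (deriv k s)"
proof -
  have "(1 - deriv k s) / (1 + deriv k s) - 1 = - 2 * deriv k s / (1 + deriv k s)"
    using one_plus_deriv_k[OF assms] by (simp add: field_simps)
  also have "norm \<dots> = 2 * norm (deriv k s) / norm (1 + deriv k s)"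
    by (simp add: norm_divide norm_mult)
  also have "\<dots> \<le> 2 * norm (deriv k s) / (1/2)"
    using one_plus_deriv_k[OF assms] by (intro divide_left_mono) auto
  finally show ?thesis by simp
qed

lemma m_bound:
  assumes "s \<in> \<Sigma>"
  shows "norm (m s - 1) \<le> 4 * norm (deriv k s)" "norm (m s) \<le> 2"
proof -
  show "norm (m s - 1) \<le> 4 * norm (deriv k s)"
    unfolding m_def using norm_csqrt_minus_one_le m_arg[OF assms] by (rule order.trans)
  then show "norm (m s) \<le> 2"
    using deriv_k_small[OF assms] norm_triangle_sub[of "m s" 1] by simp
qed

text \<open>The radicand stays within distance 1 of 1, hence in the right half-plane and off the cut
  of the root.\<close>

lemma m_hol: "m holomorphic_on \<Sigma>"
proof -
  have "deriv k holomorphic_on \<Sigma>"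
    using k_hol open_Im_strip holomorphic_deriv by blast
  then have "(\<lambda>s. (1 - deriv k s) / (1 + deriv k s)) holomorphic_on \<Sigma>"
    by (intro holomorphic_intros) (use one_plus_deriv_k k_hol open_Im_strip in auto)
  moreover have "(1 - deriv k s) / (1 + deriv k s) \<notin> \<real>\<^sub>\<le>\<^sub>0" if s: "s \<in> \<Sigma>" for s
  proof -
    have "norm ((1 - deriv k s) / (1 + deriv k s) - 1) < 1"
      using m_arg[OF s] deriv_k_small[OF s] by simp
    then have "Re ((1 - deriv k s) / (1 + deriv k s)) > 0"
      using abs_Re_le_cmod[of "(1 - deriv k s) / (1 + deriv k s) - 1"] by simp
    then show ?thesis by (simp add: complex_nonpos_Reals_iff)
  qed
  ultimately show ?thesis
    unfolding m_def by (rule holomorphic_on_csqrt')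
qed

lemma W_nonzero:
  assumes "z \<in> slit_plane" "z \<noteq> 0"
  shows "W z \<noteq> 0" "sinh (W z) \<noteq> 0"
proof -
  show "W z \<noteq> 0"
    using W_bounds(2)[OF assms(1)] S_0_iff[OF assms(1)] assms(2) by auto
  then show "sinh (W z) \<noteq> 0"
    using W_bounds(1)[OF assms(1)] pi_gt3 by (intro sinh_nonzero_strip) auto
qed

lemma h0_hol: "h0 holomorphic_on slit_plane - {0}"
proof -
  have [holomorphic_intros]: "S holomorphic_on slit_plane - {0}"
    by (rule holomorphic_on_subset[OF S_hol]) auto
  have kS: "(\<lambda>z. k (S z)) holomorphic_on slit_plane - {0}"
    using holomorphic_on_compose_gen[OF \<open>S holomorphic_on slit_plane - {0}\<close> k_hol] S_in
    by (auto simp: o_def)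
  have mS: "(\<lambda>z. m (S z)) holomorphic_on slit_plane - {0}"
    using holomorphic_on_compose_gen[OF \<open>S holomorphic_on slit_plane - {0}\<close> m_hol] S_in
    by (auto simp: o_def)
  have WS: "W holomorphic_on slit_plane - {0}"
    unfolding W_def by (intro holomorphic_intros kS)
  show ?thesis
    unfolding h0_def sinh_field_def cosh_field_def
    by (intro holomorphic_intros kS mS WS)
       (use W_nonzero in \<open>auto simp: sinh_field_def\<close>)
qed

text \<open>The factor in front of coth is bounded by a multiple of \<open>min 1 (norm s)\<close>
  and coth by \<open>1 + 6 / norm s\<close>, so the product is small both near 0 and far away. The
  total is at most half of \<open>84/5000 + 8/5000\<close>.\<close>

lemma h0_bound:
  assumes z: "z \<in> slit_plane" "z \<noteq> 0"
  shows "norm (h0 z) \<le> 1/100"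
proof -
  define s where "s = S z"
  \<comment> \<open>One number bounds \<open>k\<close>, its derivative and thereby
    \<open>m - 1\<close>; both \<open>e\<close> and \<open>e / norm s\<close> are at most
    1/5000.\<close>
  define e where "e = min 1 (norm s) / 5000"
  have s: "s \<in> \<Sigma>" "s \<noteq> 0" using S_in S_0_iff z by (auto simp: s_def)
  have e: "0 \<le> e" "e \<le> 1/5000" "e \<le> norm s / 5000" by (auto simp: e_def)
  have k: "norm (k s) \<le> e" "norm (deriv k s) \<le> e"
    using k_bound[of s] k_deriv_bound[of s] s(1) by (auto simp: e_def)
  have "norm (2 * k s) = 2 * norm (k s)" by (simp add: norm_mult)
  then have hyp: "norm (sinh (2 * k s)) \<le> 4 * e" "norm (cosh (2 * k s) - 1) \<le> 4 * e"
    using norm_sinh_le[of "2 * k s"] norm_cosh_minus_one_le[of "2 * k s"] k(1) e by auto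
  have "norm (1 - m s * cosh (2 * k s)) = norm ((m s - 1) + m s * (cosh (2 * k s) - 1))"
    by (subst norm_minus_commute) (simp add: algebra_simps)
  also have "\<dots> \<le> norm (m s - 1) + norm (m s) * norm (cosh (2 * k s) - 1)"
    by (metis norm_triangle_ineq norm_mult)
  also have "\<dots> \<le> 4 * e + 2 * (4 * e)"
    using m_bound[OF s(1)] k(2) hyp e by (intro add_mono mult_mono) auto
  finally have A: "norm (1 - m s * cosh (2 * k s)) \<le> 12 * e" by simp
  have "norm (cosh (W z) / sinh (W z)) \<le> 1 + 3 / norm (W z)"
    using norm_coth_le W_bounds W_nonzero z by blast
  also have "3 / norm (W z) \<le> 3 / (norm s / 2)"
    using W_bounds(2)[OF z(1)] s(2) W_nonzero(1)[OF z] unfolding s_def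
    by (intro divide_left_mono mult_pos_pos) auto
  finally have B: "norm (cosh (W z) / sinh (W z)) \<le> 1 + 6 / norm s" by simp
  have "norm ((1 - m s * cosh (2 * k s)) * (cosh (W z) / sinh (W z))) \<le> 12 * e * (1 + 6 / norm s)"
    unfolding norm_mult[of _ "cosh (W z) / sinh (W z)"] using A B e by (intro mult_mono) auto
  also have "\<dots> = 12 * e + 72 * (e / norm s)" using s(2) by (simp add: field_simps)
  also have "e / norm s \<le> 1/5000" using e(3) s(2) by (simp add: field_simps)
  finally have "norm ((1 - m s * cosh (2 * k s)) * (cosh (W z) / sinh (W z))) \<le> 84/5000"
    using e by linarith
  moreover have "norm (m s * sinh (2 * k s)) \<le> 2 * (4 * e)"
    unfolding norm_mult using m_bound[OF s(1)] hyp by (intro mult_mono) auto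
  moreover have "norm (h0 z) = norm ((1 - m s * cosh (2 * k s)) * (cosh (W z) / sinh (W z)) - m s * sinh (2 * k s)) / 2"
    by (simp add: h0_def s_def norm_divide)
  ultimately show ?thesis
    using norm_triangle_ineq4[of "(1 - m s * cosh (2 * k s)) * (cosh (W z) / sinh (W z))" "m s * sinh (2 * k s)"] e(2)
    by linarith
qed


text \<open>Riemann's removable singularity theorem at the centre; the bound passes to 0 by
  continuity.\<close>

lemma bounded_extension:
  obtains h where "h holomorphic_on slit_plane" "\<And>z. z \<in> slit_plane - {0} \<Longrightarrow> h z = h0 z"
    "\<And>z. z \<in> slit_plane \<Longrightarrow> norm (h z) \<le> 1/100"
proof -
  have 0: "0 \<in> slit_plane" by (simp add: slit_plane_def)
  have ev: "\<forall>\<^sub>F z in at 0. z \<in> slit_plane - {0}"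
    using eventually_at_in_open[OF open_slit_plane 0] .
  have "h0 \<in> O[at 0](\<lambda>_. 1)"
    by (rule bigoI[of _ "1/100"]) (use ev in \<open>auto elim!: eventually_mono intro: h0_bound[simplified]\<close>)
  then have "\<exists>g. g holomorphic_on slit_plane \<and> (\<forall>z\<in>slit_plane-{0}. g z = h0 z)"
    by (intro removable_singularities) (use 0 h0_hol open_slit_plane in \<open>auto simp: interior_open\<close>)
  then obtain h where h: "h holomorphic_on slit_plane" "\<And>z. z \<in> slit_plane - {0} \<Longrightarrow> h z = h0 z"
    by blast
  have b: "norm (h z) \<le> 1/100" if "z \<in> slit_plane - {0}" for z
    using h(2)[OF that] h0_bound[of z] that by simp
  have "isCont h 0"
    using h(1) 0 open_slit_plane holomorphic_on_imp_continuous_on continuous_on_eq_continuous_at by blast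
  then have "((\<lambda>z. norm (h z)) \<longlongrightarrow> norm (h 0)) (at 0)"
    unfolding isCont_def by (intro tendsto_norm)
  then have "norm (h 0) \<le> 1/100"
    by (rule tendsto_upperbound) (use ev b in \<open>auto elim!: eventually_mono\<close>)
  then have "norm (h z) \<le> 1/100" if "z \<in> slit_plane" for z
    using b that by (cases "z = 0") auto
  then show ?thesis using that h by blast
qed

section \<open>The bent lower edge and the boundary identities on it\<close>

definition line :: "complex \<Rightarrow> complex" where "line c = c - \<i> * (pi / 4)"
text \<open>The parametrization of the arc with complex parameter; its holomorphy near the real axis
  makes the arc real-analytic.\<close>

definition \<Psi> :: "complex \<Rightarrow> complex" where "\<Psi> c = tanh (E (line c))"
definition \<theta> :: "real \<Rightarrow> real" where "\<theta> x = \<kappa> x - pi / 4"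

lemma pi_eighth: "pi / 4 < 8/10" "7/10 < pi / 4"
  using pi_approx by simp_all

lemma line_in: "\<bar>Im c\<bar> < 1/2 \<Longrightarrow> line c \<in> \<Sigma>"
  using pi_eighth by (auto simp: line_def abs_if split: if_splits)

lemma Im_E_line:
  assumes "\<bar>Im c\<bar> < 1/2" shows "\<bar>Im (E (line c))\<bar> < pi / 2"
proof -
  have "\<bar>Im (k (line c))\<bar> \<le> 1/5000"
    using k_le[OF line_in[OF assms]] abs_Im_le_cmod[of "k (line c)"] by linarith
  then show ?thesis
    using assms pi_eighth by (simp add: E_def line_def)
qed

lemma S_\<Psi>:
  assumes "\<bar>Im c\<bar> < 1/2" shows "S (\<Psi> c) = line c"
  unfolding S_def \<Psi>_def artanh_tanh_complex[OF Im_E_line[OF assms]]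
  using inv_into_f_f[OF inj_E line_in[OF assms]] .

lemma \<Psi>_slit: "\<bar>Im c\<bar> < 1/2 \<Longrightarrow> \<Psi> c \<in> slit_plane"
  unfolding \<Psi>_def by (intro tanh_in_slit_plane Im_E_line)

lemma cosh_E_line: "\<bar>Im c\<bar> < 1/2 \<Longrightarrow> cosh (E (line c)) \<noteq> 0"
  by (intro cosh_nonzero_strip Im_E_line)

lemma \<Psi>_deriv:
  assumes "\<bar>Im c\<bar> < 1/2"
  shows "(\<Psi> has_field_derivative ((1 + deriv k (line c)) / (cosh (E (line c)))\<^sup>2)) (at c)"
proof -
  have l: "(line has_field_derivative 1) (at c)"
    unfolding line_def by (auto intro!: derivative_eq_intros)
  have "((\<lambda>c. k (line c)) has_field_derivative deriv k (line c) * 1) (at c)"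
    by (rule DERIV_chain2[OF k_deriv[OF line_in[OF assms]] l])
  then have "((\<lambda>c. E (line c)) has_field_derivative 1 + deriv k (line c)) (at c)"
    unfolding E_def using l by (auto intro!: derivative_eq_intros)
  then have "(\<Psi> has_field_derivative (1 - (tanh (E (line c)))\<^sup>2) * (1 + deriv k (line c))) (at c)"
    unfolding \<Psi>_def using cosh_E_line[OF assms] by (auto intro!: derivative_eq_intros)
  also have "1 - (tanh (E (line c)))\<^sup>2 =
      ((cosh (E (line c)))\<^sup>2 - (sinh (E (line c)))\<^sup>2) / (cosh (E (line c)))\<^sup>2"
    using cosh_E_line[OF assms] by (simp add: tanh_def power_divide diff_divide_distrib)
  also have "\<dots> = 1 / (cosh (E (line c)))\<^sup>2" by (simp add: hyperbolic_pythagoras)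
  finally show ?thesis by simp
qed

lemma E_line_real: "E (line (of_real x)) = Complex x (\<theta> x)"
  using k_refl[of x] by (simp add: E_def line_def \<theta>_def complex_eq_iff)

lemma \<kappa>_small: "\<bar>\<kappa> x\<bar> \<le> 1/5000"
  using k_le[OF line_in[of "of_real x"]] k_refl[of x] by (simp add: line_def norm_mult)

lemma \<theta>_bounds: "- pi / 2 < \<theta> x" "\<theta> x < 0"
  using \<kappa>_small[of x] pi_eighth by (auto simp: \<theta>_def)

text \<open>By \<open>k_refl\<close> the real part of \<open>k\<close> vanishes along the horizontal
  line, and so does its derivative in that direction.\<close>

lemma deriv_k_imaginary: "Re (deriv k (line (of_real x))) = 0"
proof -
  have "((\<lambda>t. k (line (of_real t))) has_vector_derivative 1 * deriv k (line (of_real x))) (at x)"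
  proof (rule field_vector_diff_chain_at[where g = k and f = "\<lambda>t. line (of_real t)", unfolded o_def])
    show "((\<lambda>t. line (of_real t)) has_vector_derivative 1) (at x)"
      unfolding line_def by (auto intro!: derivative_eq_intros has_vector_derivative_of_real)
    show "(k has_field_derivative deriv k (line (of_real x))) (at (line (of_real x)))"
      by (intro k_deriv line_in) simp
  qed
  then have "((\<lambda>t. Re (k (line (of_real t)))) has_real_derivative Re (deriv k (line (of_real x)))) (at x)"
    by (simp add: has_vector_derivative_complex_iff)
  moreover have "(\<lambda>t. Re (k (line (of_real t)))) = (\<lambda>t. 0)"
    using k_refl by (simp add: line_def)
  ultimately show ?thesis by (metis DERIV_const DERIV_unique)
qed

lemma cnj_cosh: "cnj (cosh z) = cosh (cnj z)" and cnj_sinh: "cnj (sinh z) = sinh (cnj z)"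
  by (simp_all add: cosh_field_def sinh_field_def exp_cnj)

text \<open>On the line \<open>Im s = - \<pi>/4\<close> the reflection of \<open>s + k s\<close> is \<open>s - k s + \<i>\<pi>/2\<close>,
  so \<open>coth (s - k s)\<close> is the Schwarz function of the curve and only the unit normal is left.\<close>

lemma h0_on_curve:
  defines "s x \<equiv> line (of_real x)"
  shows "h0 (\<Psi> (of_real x)) - cnj (\<Psi> (of_real x)) / 2 =
    - (\<i> * m (s x) * cosh (E (s x)) / cnj (cosh (E (s x)))) / 2"
proof -
  let ?k = "k (s x)" and ?C = "cosh (E (s x))"
  have S: "S (\<Psi> (of_real x)) = s x" using S_\<Psi>[of "of_real x"] by (simp add: s_def)
  have W: "W (\<Psi> (of_real x)) = s x - ?k" by (simp add: W_def S)
  have r: "s x - ?k = cnj (E (s x)) - \<i> * (pi / 2)"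
    using k_refl[of x] by (simp add: s_def E_def line_def complex_eq_iff)
  have tr: "sinh (v - \<i> * (pi / 2)) = - \<i> * cosh v" "cosh (v - \<i> * (pi / 2)) = - \<i> * sinh v" for v :: complex
  proof -
    have "\<i> * (\<i> * complex_of_real (pi / 2)) = - of_real (pi / 2)" by simp
    then have "cosh (\<i> * complex_of_real (pi / 2)) = 0" "sinh (\<i> * complex_of_real (pi / 2)) = \<i>"
      unfolding cosh_conv_cos sinh_conv_sin
      by (simp_all only: cos_minus sin_minus cos_of_real sin_of_real cos_pi_half sin_pi_half) simp_all
    then show "sinh (v - \<i> * (pi / 2)) = - \<i> * cosh v" "cosh (v - \<i> * (pi / 2)) = - \<i> * sinh v"
      by (simp_all add: sinh_diff cosh_diff)
  qed
  have sw: "sinh (W (\<Psi> (of_real x))) = - \<i> * cnj ?C" and cw: "cosh (W (\<Psi> (of_real x))) = - \<i> * cnj (sinh (E (s x)))"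
    unfolding W r tr by (simp_all add: cnj_cosh cnj_sinh)
  have C: "?C \<noteq> 0" using cosh_E_line[of "of_real x"] by (simp add: s_def)
  \<comment> \<open>The addition formula undoes the expansion in \<open>h0\<close>: the terms with
    \<open>2 * k\<close> recombine into the single value \<open>cosh (E (s x))\<close>.\<close>
  have "E (s x) = W (\<Psi> (of_real x)) + 2 * ?k" by (simp add: W E_def)
  then have "?C = cosh (W (\<Psi> (of_real x))) * cosh (2 * ?k) + sinh (W (\<Psi> (of_real x))) * sinh (2 * ?k)"
    by (simp add: cosh_add)
  then have eq: "?C = - \<i> * cnj (sinh (E (s x))) * cosh (2 * ?k) - \<i> * cnj ?C * sinh (2 * ?k)"
    unfolding sw cw by simp
  have "h0 (\<Psi> (of_real x)) - cnj (\<Psi> (of_real x)) / 2 =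
     (((1 - m (s x) * cosh (2 * ?k)) * cnj (sinh (E (s x))) - m (s x) * sinh (2 * ?k) * cnj ?C) / cnj ?C
       - cnj (sinh (E (s x))) / cnj ?C) / 2"
    unfolding h0_def S sw cw using C by (simp add: \<Psi>_def s_def tanh_def field_simps)
  also have "\<dots> = - (m (s x) * (cosh (2 * ?k) * cnj (sinh (E (s x))) + sinh (2 * ?k) * cnj ?C)) / cnj ?C / 2"
    using C by (simp add: field_simps)
  also have "cosh (2 * ?k) * cnj (sinh (E (s x))) + sinh (2 * ?k) * cnj ?C = \<i> * ?C"
    by (subst (2) eq) (simp add: algebra_simps)
  finally show ?thesis by (simp add: algebra_simps)
qed

text \<open>With \<open>deriv k (s x) = \<i> * b\<close> for real \<open>b\<close>, the square of
  \<open>m\<close> is \<open>(1 - \<i> * b) / (1 + \<i> * b)\<close>, of modulus 1, and the square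
  of \<open>m * (1 + \<i> * b)\<close> is \<open>1 + b^2 > 0\<close>. The first fact yields gradient
  length 1/2, the second makes the potential constant along the arc.\<close>

lemma m_on_line:
  defines "s x \<equiv> line (of_real x)"
  shows "norm (m (s x)) = 1" "Im (m (s x) * (1 + deriv k (s x))) = 0"
proof -
  have sin: "s x \<in> \<Sigma>" unfolding s_def by (intro line_in) simp
  obtain b where b: "deriv k (s x) = \<i> * of_real b"
    using deriv_k_imaginary[of x] unfolding s_def
    by (metis complex_eq mult_zero_right add_0 of_real_0)
  have m2: "(m (s x))\<^sup>2 = (1 - \<i> * of_real b) / (1 + \<i> * of_real b)"
    by (simp add: m_def b)
  have "norm (1 - \<i> * of_real b) = norm (1 + \<i> * of_real b)"
    by (simp add: cmod_def)
  moreover have "norm (1 + \<i> * of_real b) \<noteq> 0"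
    using one_plus_deriv_k(2)[OF sin] b by simp
  ultimately have "(norm (m (s x)))\<^sup>2 = 1"
    by (simp add: m2 norm_divide flip: norm_power)
  then show "norm (m (s x)) = 1"
    by (metis norm_ge_zero power2_eq_1_iff neg_0_le_iff_le not_one_le_zero)
  let ?q = "m (s x) * (1 + \<i> * of_real b)"
  have "?q\<^sup>2 = (1 - \<i> * of_real b) * (1 + \<i> * of_real b)"
    using one_plus_deriv_k(2)[OF sin] unfolding power_mult_distrib m2
    by (simp add: b power2_eq_square)
  also have "\<dots> = of_real (1 + b\<^sup>2)"
    by (simp add: algebra_simps power2_eq_square)
  finally have q: "?q\<^sup>2 = of_real (1 + b\<^sup>2)" .
  have "Im ?q = 0"
  proof (rule ccontr)
    assume ne: "Im ?q \<noteq> 0"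
    have "Im (?q\<^sup>2) = 0" "Re (?q\<^sup>2) = 1 + b\<^sup>2" unfolding q by simp_all
    then have "2 * Re ?q * Im ?q = 0" "(Re ?q)\<^sup>2 - (Im ?q)\<^sup>2 = 1 + b\<^sup>2"
      by (simp_all only: Im_power2 Re_power2)
    then have "- (Im ?q)\<^sup>2 = 1 + b\<^sup>2" using ne by simp
    then show False using zero_le_power2[of b] zero_le_power2[of "Im ?q"] by linarith
  qed
  then show "Im (m (s x) * (1 + deriv k (s x))) = 0" by (simp add: b)
qed

end

section \<open>The real arc: its ends, its potential and why it is not circular\<close>

context strip_perturbation
begin

definition \<Phi> :: "real \<Rightarrow> complex" where "\<Phi> x = \<Psi> (of_real x)"

lemma \<Phi>_eq_tanh: "\<Phi> x = tanh (Complex x (\<theta> x))"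
  by (simp add: \<Phi>_def \<Psi>_def E_line_real)

lemma \<Phi>_in_slit: "\<Phi> x \<in> slit_plane"
  unfolding \<Phi>_def by (intro \<Psi>_slit) simp

lemma Im_\<Phi>: "Im (\<Phi> x) < 0"
proof -
  have "cosh (Complex x (\<theta> x)) \<noteq> 0"
    using \<theta>_bounds[of x] by (intro cosh_nonzero_strip) auto
  moreover have "sin (2 * \<theta> x) < 0"
    using \<theta>_bounds[of x] sin_gt_zero[of "- (2 * \<theta> x)"] by simp
  ultimately show ?thesis
    unfolding \<Phi>_eq_tanh Im_tanh by (simp add: divide_neg_pos)
qed

lemma \<Phi>_cont: "continuous_on UNIV \<Phi>"
proof -
  have "isCont \<Psi> (of_real x)" for x
    using \<Psi>_deriv[of "of_real x"] by (simp add: DERIV_isCont)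
  then have "isCont (\<lambda>x. \<Psi> (of_real x)) x" for x
    using isCont_o2[of x complex_of_real \<Psi>] by simp
  then show ?thesis
    unfolding \<Phi>_def by (simp add: continuous_at_imp_continuous_on)
qed

lemma \<Phi>_has_vector_derivative:
  "(\<Phi> has_vector_derivative ((1 + deriv k (line (of_real x))) / (cosh (E (line (of_real x))))\<^sup>2)) (at x)"
proof -
  have "(complex_of_real has_vector_derivative 1) (at x)"
    by (auto intro!: derivative_eq_intros has_vector_derivative_of_real)
  from field_vector_diff_chain_at[OF this \<Psi>_deriv[of "of_real x"]] show ?thesis
    unfolding \<Phi>_def by (simp add: o_def)
qed

text \<open>Here the modulus of the exponential is \<open>exp (2 * x)\<close> whatever
  \<open>\<theta> x\<close> is, which gives the limits at both ends.\<close>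

lemma \<Phi>_exp: "\<Phi> x = 1 - 2 / (exp (2 * Complex x (\<theta> x)) + 1)"
proof -
  have "exp (2 * Complex x (\<theta> x)) \<notin> \<real>\<^sub>\<le>\<^sub>0"
    using \<theta>_bounds[of x] by (intro exp_not_nonpos) auto
  then have "exp (2 * Complex x (\<theta> x)) + 1 \<noteq> 0"
    by (auto simp: add_eq_0_iff2)
  then show ?thesis
    unfolding \<Phi>_eq_tanh tanh_exp_double by (simp add: field_simps)
qed

lemma norm_exp_curve: "norm (exp (2 * Complex x (\<theta> x))) = exp (2 * x)"
  by simp

lemma \<Phi>_top: "(\<Phi> \<longlongrightarrow> 1) at_top"
proof -
  have "filterlim (\<lambda>x. exp (2 * x) :: real) at_top at_top"
    by (intro filterlim_compose[OF exp_at_top] filterlim_tendsto_pos_mult_at_top[OF tendsto_const])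
       (auto simp: filterlim_ident)
  then have "filterlim (\<lambda>x. exp (2 * Complex x (\<theta> x))) at_infinity at_top"
    by (intro filterlim_norm_at_top_imp_at_infinity) (simp only: norm_exp_curve)
  then have "filterlim (\<lambda>x. exp (2 * Complex x (\<theta> x)) + 1) at_infinity at_top"
    by (intro tendsto_add_filterlim_at_infinity'[OF _ tendsto_const])
  then have "((\<lambda>x. 1 - 2 / (exp (2 * Complex x (\<theta> x)) + 1)) \<longlongrightarrow> 1 - 0) at_top"
    by (intro tendsto_intros tendsto_divide_0[OF tendsto_const])
  then show ?thesis unfolding \<Phi>_exp[symmetric] by simp
qed

lemma \<Phi>_bot: "(\<Phi> \<longlongrightarrow> -1) at_bot"
proof -
  have "((\<lambda>x. exp (2 * x) :: real) \<longlongrightarrow> 0) at_bot"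
    by (intro filterlim_compose[OF exp_at_bot] filterlim_tendsto_pos_mult_at_bot[OF tendsto_const])
       (auto simp: filterlim_ident)
  then have "((\<lambda>x. exp (2 * Complex x (\<theta> x))) \<longlongrightarrow> 0) at_bot"
    by (subst tendsto_norm_zero_iff[symmetric]) (simp only: norm_exp_curve)
  then have "((\<lambda>x. 1 - 2 / (exp (2 * Complex x (\<theta> x)) + 1)) \<longlongrightarrow> 1 - 2 / (0 + 1)) at_bot"
    by (intro tendsto_intros) auto
  then show ?thesis unfolding \<Phi>_exp[symmetric] by simp
qed

text \<open>Take a primitive of \<open>h\<close> on the starlike slit plane. The potential has zero
  derivative along the arc, so it is constant there, and subtracting this constant from the
  primitive makes it vanish.\<close>

lemma potential_exists:
  obtains F h where "slit_potential F h \<Phi>"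
proof -
  obtain h where h: "h holomorphic_on slit_plane" "\<And>z. z \<in> slit_plane - {0} \<Longrightarrow> h z = h0 z"
    "\<And>z. z \<in> slit_plane \<Longrightarrow> norm (h z) \<le> 1/100"
    using bounded_extension by blast
  have "\<exists>G. \<forall>z\<in>slit_plane. (G has_field_derivative h z) (at z)"
    using holomorphic_starlike_primitive[of slit_plane h "{}"] h(1) starlike_slit_plane open_slit_plane
    by (auto simp: holomorphic_on_imp_continuous_on holomorphic_on_open field_differentiable_def)
  then obtain G where G: "\<And>z. z \<in> slit_plane \<Longrightarrow> (G has_field_derivative h z) (at z)"
    by blast
  \<comment> \<open>The arc avoids the centre, so the extension \<open>h\<close> is given by the
    explicit \<open>h0\<close> on it.\<close>
  have "\<Phi> x \<noteq> 0" for x using Im_\<Phi>[of x] by auto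
  then have hc: "h (\<Phi> x) - cnj (\<Phi> x) / 2 = - (\<i> * m (line (of_real x)) * cosh (E (line (of_real x))) /
      cnj (cosh (E (line (of_real x))))) / 2" for x
    using h0_on_curve[of x] h(2)[of "\<Phi> x"] \<Phi>_in_slit[of x] unfolding \<Phi>_def by auto
  have cosh: "cosh (E (line (of_real x))) \<noteq> 0" for x by (intro cosh_E_line) simp
  define U where "U x = Re (G (\<Phi> x)) - (\<Phi> x \<bullet> \<Phi> x) / 4" for x
  have "(U has_real_derivative 0) (at x)" for x
  proof -
    define d where "d = (1 + deriv k (line (of_real x))) / (cosh (E (line (of_real x))))\<^sup>2"
    have d: "(\<Phi> has_vector_derivative d) (at x)"
      unfolding d_def by (rule \<Phi>_has_vector_derivative)
    have "((\<lambda>x. G (\<Phi> x)) has_vector_derivative (d * h (\<Phi> x))) (at x)"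
      using field_vector_diff_chain_at[OF d G[OF \<Phi>_in_slit]] by (simp add: o_def)
    then have "((\<lambda>x. G (\<Phi> x)) has_derivative (\<lambda>t. t *\<^sub>R (d * h (\<Phi> x)))) (at x)"
      by (simp add: has_vector_derivative_def)
    moreover have "(\<Phi> has_derivative (\<lambda>t. t *\<^sub>R d)) (at x)"
      using d by (simp add: has_vector_derivative_def)
    ultimately have "(U has_derivative (\<lambda>t. Re (t *\<^sub>R (d * h (\<Phi> x))) - (\<Phi> x \<bullet> (t *\<^sub>R d) + (t *\<^sub>R d) \<bullet> \<Phi> x) / 4)) (at x)"
      unfolding U_def by (auto intro!: derivative_eq_intros)
    also have "(\<lambda>t. Re (t *\<^sub>R (d * h (\<Phi> x))) - (\<Phi> x \<bullet> (t *\<^sub>R d) + (t *\<^sub>R d) \<bullet> \<Phi> x) / 4) =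
        (\<lambda>t. t * Re ((h (\<Phi> x) - cnj (\<Phi> x) / 2) * d))"
      by (auto simp: inner_complex_def algebra_simps)
    \<comment> \<open>The tangent \<open>d\<close> contributes \<open>1 + deriv k\<close> over the
      square of cosh, so the product is \<open>\<i>\<close> times the real number
      \<open>m * (1 + deriv k)\<close> up to a real factor.\<close>
    also have "Re ((h (\<Phi> x) - cnj (\<Phi> x) / 2) * d) = 0"
    proof -
      let ?C = "cosh (E (line (of_real x)))" and ?q = "m (line (of_real x)) * (1 + deriv k (line (of_real x)))"
      have "(h (\<Phi> x) - cnj (\<Phi> x) / 2) * d = - \<i> * ?q / (?C * cnj ?C) / 2"
        unfolding hc d_def using cosh[of x] by (simp add: field_simps power2_eq_square)
      also have "?C * cnj ?C = of_real ((norm ?C)\<^sup>2)" by (rule complex_norm_square[symmetric])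
      finally show ?thesis using m_on_line(2)[of x] by simp
    qed
    finally have "(U has_derivative (\<lambda>t. 0)) (at x)" by simp
    moreover have "(*) (0::real) = (\<lambda>t. 0)" by auto
    ultimately show ?thesis by (simp only: has_field_derivative_def)
  qed
  then have "\<forall>x. (U has_real_derivative 0) (at x)" ..
  then have U: "U x = U 0" for x by (rule DERIV_isconst_all)
  have "slit_potential (\<lambda>z. G z - of_real (U 0)) h \<Phi>"
  proof
    fix z assume z: "z \<in> slit_plane"
    show "((\<lambda>z. G z - of_real (U 0)) has_field_derivative h z) (at z)"
      using G[OF z] by (auto intro!: derivative_eq_intros)
    show "norm (h z) \<le> 1/100" by (rule h(3)[OF z])
  next
    fix t
    show "Im (\<Phi> t) < 0" by (rule Im_\<Phi>)
    show "Re (G (\<Phi> t) - of_real (U 0)) = (norm (\<Phi> t))\<^sup>2 / 4"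
      using U[of t] by (simp add: U_def power2_norm_eq_inner)
    show "norm (h (\<Phi> t) - cnj (\<Phi> t) / 2) = 1/2"
      unfolding hc using cosh[of t] by (simp add: norm_divide norm_mult m_on_line(1))
  qed (rule \<Phi>_cont \<Phi>_top \<Phi>_bot)+
  then show ?thesis by (rule that)
qed

text \<open>The hypothesis is the equation of a circle through 1 and -1. On the arc it fixes the
  cotangent of \<open>2 * \<theta> x\<close>, and since this angle lies between \<open>- pi\<close>
  and 0, \<open>\<theta>\<close> is constant.\<close>

lemma curve_not_circular:
  assumes "\<And>x. (norm (\<Phi> x))\<^sup>2 - 1 = y * Im (\<Phi> x)"
  shows "\<kappa> a = \<kappa> b"
proof -
  have "y * sin (2 * \<theta> x) = - 2 * cos (2 * \<theta> x)" for x
  proof -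
    have c: "cosh (Complex x (\<theta> x)) \<noteq> 0"
      using \<theta>_bounds[of x] by (intro cosh_nonzero_strip) auto
    show ?thesis
      using assms[of x] c unfolding \<Phi>_eq_tanh Im_tanh norm_tanh_squared[OF c]
      by (simp add: field_simps)
  qed
  then have *: "2 * cos (2 * \<theta> x) = - (y * sin (2 * \<theta> x))" for x
    by simp
  have "sin (2 * \<theta> a - 2 * \<theta> b) * 2 = sin (2 * \<theta> a) * (2 * cos (2 * \<theta> b)) - (2 * cos (2 * \<theta> a)) * sin (2 * \<theta> b)"
    by (simp add: sin_diff)
  also have "\<dots> = 0"
    unfolding * by simp
  finally have "sin (2 * \<theta> a - 2 * \<theta> b) = 0" by simp
  moreover have "\<bar>2 * \<theta> a - 2 * \<theta> b\<bar> < pi"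
    using \<theta>_bounds[of a] \<theta>_bounds[of b] by simp
  ultimately have "2 * \<theta> a - 2 * \<theta> b = 0" unfolding abs_less_iff by (elim conjE) (rule sin_eq_0_pi; linarith)
  then show ?thesis by (simp add: \<theta>_def)
qed

end

section \<open>An explicit perturbation\<close>

text \<open>Zeros at 0 and at its mirror image in the line \<open>Im s = - pi / 4\<close>, and poles
  placed symmetrically outside the strip: hence real values on that line, with a bound at
  infinity.\<close>

definition bump :: "complex \<Rightarrow> complex" where
  "bump s = s * (s + \<i> * (pi / 2)) / ((s + \<i> * (pi / 4))\<^sup>2 + 16)"

definition bump' :: "complex \<Rightarrow> complex" where
  "bump' s = of_real (16 - (pi / 4)\<^sup>2) * (2 * (s + \<i> * (pi / 4))) / ((s + \<i> * (pi / 4))\<^sup>2 + 16)\<^sup>2"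

text \<open>In the variable \<open>x\<close> centred on the edge the poles are at
  \<open>4 * \<i>\<close> and \<open>- 4 * \<i>\<close>, while \<open>|Im x| < 3\<close>; so both
  linear factors have modulus at least 1.\<close>

lemma bump_factors:
  assumes "\<bar>Im s\<bar> < 2"
  defines "x \<equiv> s + \<i> * (pi / 4)"
  shows "norm (x + 4 * \<i>) \<ge> 1" "norm (x - 4 * \<i>) \<ge> 1"
    "x\<^sup>2 + 16 = (x + 4 * \<i>) * (x - 4 * \<i>)" "x\<^sup>2 + 16 \<noteq> 0"
proof -
  have "0 < pi / 4" "pi / 4 < 1" using pi_less_4 by simp_all
  moreover have "Im x = Im s + pi / 4" by (simp add: x_def)
  ultimately have "\<bar>Im x\<bar> < 3" using assms(1) by linarith
  then have "1 \<le> \<bar>Im (x + 4 * \<i>)\<bar>" "1 \<le> \<bar>Im (x - 4 * \<i>)\<bar>" by simp_all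
  then show 1: "norm (x + 4 * \<i>) \<ge> 1" "norm (x - 4 * \<i>) \<ge> 1"
    using abs_Im_le_cmod order.trans by blast+
  show 2: "x\<^sup>2 + 16 = (x + 4 * \<i>) * (x - 4 * \<i>)"
    by (simp add: algebra_simps power2_eq_square)
  show "x\<^sup>2 + 16 \<noteq> 0" unfolding 2 using 1 by auto
qed

lemma bump_alt:
  assumes "\<bar>Im s\<bar> < 2"
  shows "bump s = 1 - of_real (16 - (pi / 4)\<^sup>2) / ((s + \<i> * (pi / 4))\<^sup>2 + 16)"
proof -
  have "s * (s + \<i> * (pi / 2)) = ((s + \<i> * (pi / 4))\<^sup>2 + 16) - of_real (16 - (pi / 4)\<^sup>2)"
    by (simp add: algebra_simps power2_eq_square)
  then show ?thesis
    unfolding bump_def using bump_factors(4)[OF assms]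
    by (simp only: diff_divide_distrib divide_self_if if_False)
qed

lemma pi_quarter_sq: "0 < 16 - (pi / 4)\<^sup>2" "16 - (pi / 4)\<^sup>2 \<le> (16::real)" "(pi / 4)\<^sup>2 < (1::real)"
proof -
  have "(pi / 4)\<^sup>2 < 1\<^sup>2"
    using pi_less_4 by (intro power_strict_mono) auto
  then show "0 < 16 - (pi / 4)\<^sup>2" "16 - (pi / 4)\<^sup>2 \<le> (16::real)" "(pi / 4)\<^sup>2 < (1::real)" by auto
qed

lemma norm_bump_le:
  assumes "\<bar>Im s\<bar> < 2"
  shows "norm (bump s) \<le> 32"
proof -
  have "1 * 1 \<le> norm (s + \<i> * (pi / 4) + 4 * \<i>) * norm (s + \<i> * (pi / 4) - 4 * \<i>)"
    using bump_factors(1,2)[OF assms] by (intro mult_mono) auto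
  then have "1 \<le> norm ((s + \<i> * (pi / 4))\<^sup>2 + 16)"
    unfolding bump_factors(3)[OF assms] norm_mult by simp
  then have "norm (complex_of_real (16 - (pi / 4)\<^sup>2) / ((s + \<i> * (pi / 4))\<^sup>2 + 16)) \<le> 16 / 1"
    unfolding norm_divide norm_of_real using pi_quarter_sq by (intro frac_le) auto
  then show ?thesis
    unfolding bump_alt[OF assms]
    using norm_triangle_ineq4[of 1 "complex_of_real (16 - (pi / 4)\<^sup>2) / ((s + \<i> * (pi / 4))\<^sup>2 + 16)"] by simp
qed

lemma norm_bump'_le:
  assumes "\<bar>Im s\<bar> < 2"
  shows "norm (bump' s) \<le> 32"
proof -
  define x where "x = s + \<i> * (pi / 4)"
  note f = bump_factors[OF assms, folded x_def]
  have nz: "x + 4 * \<i> \<noteq> 0" "x - 4 * \<i> \<noteq> 0" using f by auto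
  \<comment> \<open>Partial fractions write \<open>2 * x / (x^2 + 16)\<close> as a sum of two terms
    of modulus at most 1, which avoids any bound on \<open>x\<close>.\<close>
  have "bump' s = of_real (16 - (pi / 4)\<^sup>2) * ((1 / (x + 4 * \<i>) + 1 / (x - 4 * \<i>)) * (1 / (x + 4 * \<i>)) * (1 / (x - 4 * \<i>)))"
    unfolding bump'_def x_def[symmetric] f(3) using nz by (simp add: field_simps power2_eq_square)
  also have "norm \<dots> = (16 - (pi / 4)\<^sup>2) * (norm (1 / (x + 4 * \<i>) + 1 / (x - 4 * \<i>)) * norm (1 / (x + 4 * \<i>)) * norm (1 / (x - 4 * \<i>)))"
    using pi_quarter_sq(1) by (simp only: norm_mult norm_of_real abs_of_pos)
  also have "\<dots> \<le> 16 * (2 * 1 * 1)"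
  proof (intro mult_mono)
    have "norm (1 / (x + 4 * \<i>)) \<le> 1" "norm (1 / (x - 4 * \<i>)) \<le> 1"
      using f by (auto simp: norm_divide divide_le_eq_1)
    then show "norm (1 / (x + 4 * \<i>)) \<le> 1" "norm (1 / (x - 4 * \<i>)) \<le> 1"
      "norm (1 / (x + 4 * \<i>) + 1 / (x - 4 * \<i>)) \<le> 2"
      using norm_triangle_ineq[of "1 / (x + 4 * \<i>)" "1 / (x - 4 * \<i>)"] by linarith+
  qed (use pi_quarter_sq in auto)
  finally show ?thesis by simp
qed

lemma bump_deriv:
  assumes "\<bar>Im s\<bar> < 2"
  shows "(bump has_field_derivative bump' s) (at s)"
proof -
  have "((\<lambda>s. 1 - of_real (16 - (pi / 4)\<^sup>2) / ((s + \<i> * (pi / 4))\<^sup>2 + 16)) has_field_derivative bump' s) (at s)"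
    unfolding bump'_def using bump_factors(4)[OF assms]
    by (auto intro!: derivative_eq_intros simp: power2_eq_square)
  then show ?thesis
    by (rule has_field_derivative_transform_within_open[OF _ open_Im_strip[of 2]])
       (use assms bump_alt in auto)
qed

lemma norm_bump_le_linear:
  assumes "\<bar>Im s\<bar> < 2"
  shows "norm (bump s) \<le> 32 * norm s"
proof -
  have "norm (bump s - bump 0) \<le> 32 * norm (s - 0)"
  by (rule field_differentiable_bound[OF convex_Im_strip[of 2]])
       (use assms bump_deriv norm_bump'_le in \<open>auto intro: has_field_derivative_at_within\<close>)
  then show ?thesis by (simp add: bump_def)
qed

text \<open>Squaring gives the double zero at 0, and the factor \<open>\<i>\<close> makes the values
  imaginary on the edge. The constant is \<open>2^(-24)\<close>: the derivative is bounded by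
  \<open>2 * 32 * 32 = 2^11\<close> before scaling, and \<open>2^(-13) < 1/5000\<close>.\<close>

definition pert :: "complex \<Rightarrow> complex" where
  "pert s = \<i> * of_real (1 / 16777216) * (bump s)\<^sup>2"

definition pert_real :: "real \<Rightarrow> real" where
  "pert_real x = 1 / 16777216 * ((x\<^sup>2 + (pi / 4)\<^sup>2) / (x\<^sup>2 + 16))\<^sup>2"

lemma pert_deriv:
  assumes "\<bar>Im s\<bar> < 2"
  shows "(pert has_field_derivative \<i> * of_real (1 / 16777216) * (2 * bump s * bump' s)) (at s)"
  unfolding pert_def using bump_deriv[OF assms] by (auto intro!: derivative_eq_intros)

lemma norm_bump_le_min:
  assumes "\<bar>Im s\<bar> < 2"
  shows "norm (bump s) \<le> 32 * min 1 (norm s)"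
  using norm_bump_le[OF assms] norm_bump_le_linear[OF assms] by (simp add: min_def)

lemma strip_perturbation_pert: "strip_perturbation pert pert_real"
proof
  show "pert holomorphic_on {s. \<bar>Im s\<bar> < 2}"
    unfolding holomorphic_on_def field_differentiable_def
    using pert_deriv by (auto intro: has_field_derivative_at_within)
next
  fix s :: complex assume s: "\<bar>Im s\<bar> < 2"
  have m: "0 \<le> min 1 (norm s)" by simp
  have "norm (bump s) * norm (bump s) \<le> (32 * min 1 (norm s)) * 32"
    using norm_bump_le_min[OF s] norm_bump_le[OF s] by (intro mult_mono) auto
  moreover have "norm (pert s) = (norm (bump s) * norm (bump s)) / 16777216"
    by (simp add: pert_def norm_mult norm_power power2_eq_square)
  ultimately show "norm (pert s) \<le> min 1 (norm s) / 5000"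
    using m by linarith
  have "norm (bump s) * norm (bump' s) \<le> (32 * min 1 (norm s)) * 32"
    using norm_bump_le_min[OF s] norm_bump'_le[OF s] by (intro mult_mono) auto
  moreover have "norm (deriv pert s) = 2 * (norm (bump s) * norm (bump' s)) / 16777216"
    unfolding DERIV_imp_deriv[OF pert_deriv[OF s]] by (simp add: norm_mult)
  ultimately show "norm (deriv pert s) \<le> min 1 (norm s) / 5000"
    using m by linarith
next
  fix x :: real
  have "bump (of_real x - \<i> * (pi / 4)) = of_real ((x\<^sup>2 + (pi / 4)\<^sup>2) / (x\<^sup>2 + 16))"
    unfolding bump_def by (simp add: algebra_simps power2_eq_square)
  then show "pert (of_real x - \<i> * (pi / 4)) = \<i> * of_real (pert_real x)"
    unfolding pert_def pert_real_def by (simp add: power_divide)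
qed

lemma pert_real_nonconstant: "pert_real 0 \<noteq> pert_real 4"
proof -
  have "((pi / 4)\<^sup>2 / 16)\<^sup>2 < ((16 + (pi / 4)\<^sup>2) / 32)\<^sup>2"
    using pi_quarter_sq(3) zero_le_power2[of "pi / 4"]
    by (intro power_strict_mono) (auto simp del: zero_le_power2)
  moreover have "pert_real 0 = 1 / 16777216 * ((pi / 4)\<^sup>2 / 16)\<^sup>2"
    "pert_real 4 = 1 / 16777216 * ((16 + (pi / 4)\<^sup>2) / 32)\<^sup>2"
    by (simp_all add: pert_real_def)
  ultimately show ?thesis by linarith
qed

section \<open>Transfer to the real plane\<close>

text \<open>The factor 2 scales the domain, which is close to the unit disk, into the open square.\<close>

definition to_complex :: "real ^ 2 \<Rightarrow> complex" where
  "to_complex x = Complex (2 * x $ 1) (2 * x $ 2)"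

definition to_plane :: "complex \<Rightarrow> real ^ 2" where
  "to_plane z = (\<chi> i. if i = 1 then Re z / 2 else Im z / 2)"

lemma to_plane_nth [simp]: "to_plane z $ 1 = Re z / 2" "to_plane z $ 2 = Im z / 2"
  by (simp_all add: to_plane_def)

lemma to_complex_to_plane [simp]: "to_complex (to_plane z) = z"
  by (simp add: to_complex_def)

lemma to_plane_to_complex [simp]: "to_plane (to_complex x) = x"
  by (simp add: vec_eq_iff forall_2 to_complex_def)

lemma linear_to_complex: "linear to_complex"
  by (rule linearI) (simp_all add: to_complex_def complex_eq_iff algebra_simps)

lemma linear_to_plane: "linear to_plane"
  by (rule linearI) (simp_all add: vec_eq_iff forall_2 add_divide_distrib)

lemma bounded_linear_to_complex: "bounded_linear to_complex"
  using linear_to_complex linear_conv_bounded_linear by blast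

lemma bounded_linear_to_plane: "bounded_linear to_plane"
  using linear_to_plane linear_conv_bounded_linear by blast

lemmas to_complex_simps = linear_add[OF linear_to_complex] linear_diff[OF linear_to_complex]
  linear_cmul[OF linear_to_complex]

lemma continuous_on_to_complex [continuous_intros]:
  "continuous_on A f \<Longrightarrow> continuous_on A (\<lambda>x. to_complex (f x))"
  by (rule bounded_linear.continuous_on[OF bounded_linear_to_complex])

lemma continuous_on_to_plane [continuous_intros]:
  "continuous_on A f \<Longrightarrow> continuous_on A (\<lambda>x. to_plane (f x))"
  by (rule bounded_linear.continuous_on[OF bounded_linear_to_plane])

lemma inj_to_plane: "inj to_plane"
  by (metis injI to_complex_to_plane)

lemma bij_to_plane: "bij to_plane"
  by (metis bijI inj_to_plane surjI to_plane_to_complex)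

lemma to_plane_image: "to_plane ` A = {x. to_complex x \<in> A}"
  by (auto intro!: image_eqI[of _ to_plane "to_complex _"])

lemma norm_to_complex: "norm (to_complex x) = 2 * norm x"
proof -
  have "norm x = sqrt ((x $ 1)\<^sup>2 + (x $ 2)\<^sup>2)"
    by (simp add: norm_vec_def L2_set_def sum_2)
  moreover have "norm (to_complex x) = sqrt (4 * ((x $ 1)\<^sup>2 + (x $ 2)\<^sup>2))"
    by (simp add: to_complex_def cmod_def power_mult_distrib algebra_simps)
  ultimately show ?thesis by (simp only: real_sqrt_mult real_sqrt_four)
qed

lemma closure_to_plane: "closure (to_plane ` A) = to_plane ` closure A"
  by (rule closure_injective_linear_image[OF linear_to_plane inj_to_plane, symmetric])

lemma frontier_to_plane: "frontier (to_plane ` A) = to_plane ` frontier A"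
proof -
  have "- (to_plane ` A) = to_plane ` (- A)"
    by (rule bij_image_Compl_eq[OF bij_to_plane, symmetric])
  then show ?thesis
    by (simp add: frontier_closures closure_to_plane image_Int[OF inj_to_plane])
qed

lemma partial_derivativeI:
  "(f has_derivative f') (at x) \<Longrightarrow> partial_derivative i f x = f' (axis i 1)"
  by (simp add: partial_derivative_def frechet_derivative_at[symmetric])

text \<open>Adds the data about the arc itself: \<open>\<Psi>\<close> makes it analytic and regular,
  the continuous \<open>\<iota>\<close> recovers the parameter and so makes it embedded, and
  \<open>not_circular\<close> rules out a disk.\<close>

locale overdetermined_arc = slit_potential F h \<Phi>
  for F h \<Phi> +
  fixes \<Psi> :: "complex \<Rightarrow> complex" and \<iota> :: "complex \<Rightarrow> real"
  assumes \<Psi>_hol: "\<Psi> holomorphic_on {c. \<bar>Im c\<bar> < 1/2}"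
    and \<Phi>_eq: "\<Phi> t = \<Psi> (of_real t)"
    and \<Psi>_deriv_nz: "deriv \<Psi> (of_real t) \<noteq> 0"
    and \<iota>_cont: "continuous_on slit_plane \<iota>"
    and \<iota>_\<Phi>: "\<iota> (\<Phi> t) = t"
    and not_circular: "\<not> (\<forall>t. (norm (\<Phi> t))\<^sup>2 - 1 = y * Im (\<Phi> t))"
begin

definition \<Omega> :: "(real ^ 2) set" where "\<Omega> = to_plane ` Om"
definition \<Gamma> :: "(real ^ 2) set" where "\<Gamma> = to_plane ` range \<Phi>"
text \<open>Division by 4 offsets the factor 4 that the dilation by 2 puts on the Laplacian; the
  gradient length 1/2 on the arc becomes 1/4.\<close>

definition w :: "real ^ 2 \<Rightarrow> real" where "w x = u (to_complex x) / 4"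
definition D :: "(real ^ 2) set" where "D = {x. to_complex x \<in> slit_plane}"

section \<open>The planar domain and its analytic boundary arc\<close>

lemma \<Omega>_iff: "x \<in> \<Omega> \<longleftrightarrow> to_complex x \<in> Om"
  by (simp add: \<Omega>_def to_plane_image)

lemma \<Gamma>_iff: "x \<in> \<Gamma> \<longleftrightarrow> to_complex x \<in> range \<Phi>"
  by (simp add: \<Gamma>_def to_plane_image)

lemma open_D: "open D"
  unfolding D_def using open_vimage[OF open_slit_plane, of to_complex]
  by (simp add: continuous_intros vimage_def)

lemma \<Omega>_subset: "\<Omega> \<subseteq> D" and \<Gamma>_subset: "\<Gamma> \<subseteq> D"
  using \<Phi>_slit by (auto simp: \<Omega>_iff \<Gamma>_iff D_def Om_def)

lemma open_\<Omega>: "open \<Omega>"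
  unfolding \<Omega>_def to_plane_image using open_vimage[OF open_Om, of to_complex]
  by (simp add: continuous_intros vimage_def)

lemma starlike_\<Omega>: "starlike \<Omega>"
  unfolding starlike_def
proof (intro bexI ballI)
  show "to_plane 0 \<in> \<Omega>" using zero_in_Om by (simp add: \<Omega>_iff)
  fix x assume "x \<in> \<Omega>"
  then obtain z where "x = to_plane z" "z \<in> Om" by (auto simp: \<Omega>_def)
  then show "closed_segment (to_plane 0) x \<subseteq> \<Omega>"
    using starlike_Om[of z] by (auto simp: \<Omega>_def closed_segment_linear_image[OF linear_to_plane])
qed

lemma planar_domain_\<Omega>: "planar_domain \<Omega>"
  using open_\<Omega> starlike_\<Omega> starlike_imp_connected zero_in_Om
  by (auto simp: planar_domain_def \<Omega>_def)

lemma \<Omega>_in_square: "\<Omega> \<subseteq> {x. \<forall>i. -1 < x $ i \<and> x $ i < 1}"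
proof (intro subsetI CollectI allI)
  fix x i assume "x \<in> \<Omega>"
  then have "norm x < 1" using Om_norm_less[of "to_complex x"] by (simp add: \<Omega>_iff norm_to_complex)
  moreover have "\<bar>x $ i\<bar> \<le> norm x" by (rule component_le_norm_cart)
  ultimately show "-1 < x $ i \<and> x $ i < 1" by linarith
qed

lemma frontier_\<Omega>: "frontier \<Omega> = to_plane ` ({z \<in> slit_plane. u z = 0} \<union> {1, -1})"
  by (simp add: \<Omega>_def frontier_to_plane frontier_Om)

lemma \<Gamma>_eq: "\<Gamma> = frontier \<Omega> \<inter> {x. x $ 2 < 0}"
  unfolding \<Gamma>_def range_\<Phi> \<Omega>_def frontier_to_plane by auto

lemma w_frontier: "x \<in> frontier \<Omega> \<Longrightarrow> w x = 0"
  using one_notin_slit[of 1] one_notin_slit[of "-1"] by (auto simp: frontier_\<Omega> w_def u_def[of 1] u_def[of "-1"])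

text \<open>The boundary circle would pass through the images of 1 and -1, so its centre would lie
  on the imaginary axis and the arc would satisfy the equation excluded by
  \<open>not_circular\<close>.\<close>

lemma not_ball: "\<Omega> \<noteq> ball a r"
proof
  assume eq: "\<Omega> = ball a r"
  then have "r > 0" using planar_domain_\<Omega> by (metis ball_eq_empty not_le planar_domain_def)
  then have fr: "frontier \<Omega> = sphere a r" by (simp add: eq frontier_ball)
  define A where "A = to_complex a"
  have d: "norm (z - A) = 2 * r" if "z \<in> frontier Om" for z
  proof -
    have "to_plane z \<in> sphere a r" using that fr by (auto simp: \<Omega>_def frontier_to_plane)
    then have "norm (to_plane z - a) = r" by (simp add: dist_norm norm_minus_commute)
    then show ?thesis
      using norm_to_complex[of "to_plane z - a"] by (simp add: A_def to_complex_simps)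
  qed
  have sq: "(Re z - Re A)\<^sup>2 + (Im z - Im A)\<^sup>2 = (2 * r)\<^sup>2" if "z \<in> frontier Om" for z
    using d[OF that] by (simp flip: d[OF that] add: cmod_power2)
  have "1 \<in> frontier Om" "-1 \<in> frontier Om" by (auto simp: frontier_Om)
  note e = sq[OF this(1)] sq[OF this(2)]
  have A: "Re A = 0" using e by (simp add: power2_eq_square algebra_simps)
  have "(norm (\<Phi> t))\<^sup>2 - 1 = (2 * Im A) * Im (\<Phi> t)" for t
  proof -
    have "\<Phi> t \<in> frontier Om" using range_\<Phi> by auto
    from sq[OF this] e(1) show ?thesis
      unfolding cmod_power2 using A by (simp add: power2_eq_square algebra_simps)
  qed
  then show False using not_circular by blast
qed

lemma has_vector_derivative_\<Phi>: "(\<Phi> has_vector_derivative deriv \<Psi> (of_real t)) (at t)"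
proof -
  have "(\<Psi> has_field_derivative deriv \<Psi> (of_real t)) (at (of_real t))"
    by (intro holomorphic_derivI[OF \<Psi>_hol open_Im_strip]) simp
  moreover have "(complex_of_real has_vector_derivative 1) (at t)"
    by (auto intro!: derivative_eq_intros has_vector_derivative_of_real)
  ultimately have "(\<Psi> \<circ> complex_of_real has_vector_derivative 1 * deriv \<Psi> (of_real t)) (at t)"
    by (intro field_vector_diff_chain_at)
  moreover have "\<Psi> \<circ> complex_of_real = \<Phi>" by (auto simp: \<Phi>_eq)
  ultimately show ?thesis by simp
qed

text \<open>The Taylor series of \<open>\<Psi>\<close> converges on the disk of radius 1/2 about a
  real point, which fits in its strip of holomorphy; \<open>to_plane\<close> is applied
  termwise.\<close>

lemma real_analytic_\<Phi>: "(\<lambda>t. to_plane (\<Phi> t)) real_analytic_on A"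
  unfolding real_analytic_on_def
proof
  fix t0 assume "t0 \<in> A"
  define c where "c n = (deriv ^^ n) \<Psi> (of_real t0) / fact n" for n
  have "(\<lambda>n. (t - t0) ^ n *\<^sub>R to_plane (c n)) sums to_plane (\<Phi> t)" if t: "\<bar>t - t0\<bar> < 1/2" for t
  proof -
    have "\<bar>Im z\<bar> < 1/2" if "z \<in> ball (of_real t0) (1/2)" for z
      using abs_Im_le_cmod[of "z - of_real t0"] that by (simp add: dist_norm norm_minus_commute)
    then have "\<Psi> holomorphic_on ball (of_real t0) (1/2)"
      by (intro holomorphic_on_subset[OF \<Psi>_hol]) auto
    moreover have "complex_of_real t \<in> ball (of_real t0) (1/2)"
      using t by (simp add: dist_of_real dist_real_def abs_minus_commute)
    ultimately have "(\<lambda>n. c n * (of_real t - of_real t0) ^ n) sums \<Phi> t"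
      unfolding c_def \<Phi>_eq by (rule holomorphic_power_series)
    from bounded_linear.sums[OF bounded_linear_to_plane this]
    have "(\<lambda>n. to_plane (c n * (of_real t - of_real t0) ^ n)) sums to_plane (\<Phi> t)" .
    moreover have "c n * (of_real t - of_real t0) ^ n = (t - t0) ^ n *\<^sub>R c n" for n
      by (simp add: scaleR_conv_of_real)
    ultimately show ?thesis
      by (simp add: linear_cmul[OF linear_to_plane])
  qed
  then show "\<exists>a r. r > 0 \<and> (\<forall>t. \<bar>t - t0\<bar> < r \<longrightarrow> (\<lambda>n. (t - t0) ^ n *\<^sub>R a n) sums to_plane (\<Phi> t))"
    by (intro exI[of _ "\<lambda>n. to_plane (c n)"] exI[of _ "1/2"]) auto
qed

lemma analytic_\<Gamma>: "analytic_boundary_subset \<Omega> \<Gamma>"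
  unfolding analytic_boundary_subset_def
proof
  have "open {x::real^2. x $ 2 < 0}" by (rule open_halfspace_component_lt_cart)
  then show "openin (top_of_set (frontier \<Omega>)) \<Gamma>"
    unfolding \<Gamma>_eq by (rule openin_open_Int)
  show "real_analytic_curve \<Gamma>"
    unfolding real_analytic_curve_def
  proof
    fix p assume "p \<in> \<Gamma>"
    then obtain t0 where t0: "p = to_plane (\<Phi> t0)" by (auto simp: \<Gamma>_def)
    \<comment> \<open>Cutting by the parameter \<open>\<iota>\<close> instead of by distance makes
      \<open>\<Gamma> \<inter> U\<close> exactly the image of one parameter interval, with
      \<open>\<iota>\<close> as inverse chart.\<close>
    define U where "U = {x \<in> D. \<iota> (to_complex x) \<in> {t0 - 1<..<t0 + 1}}"
    have cont: "continuous_on D (\<lambda>x. \<iota> (to_complex x))"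
      by (rule continuous_on_compose2[OF \<iota>_cont]) (auto intro!: continuous_intros simp: D_def)
    have "U = D \<inter> (\<lambda>x. \<iota> (to_complex x)) -` {t0 - 1<..<t0 + 1}"
      by (auto simp: U_def)
    then have "open U"
      using continuous_open_preimage[OF cont open_D open_greaterThanLessThan] by simp
    moreover have "p \<in> U"
      using \<Phi>_slit by (simp add: U_def t0 D_def \<iota>_\<Phi>)
    moreover have "homeomorphism {t0 - 1<..<t0 + 1} (\<Gamma> \<inter> U) (\<lambda>t. to_plane (\<Phi> t)) (\<lambda>x. \<iota> (to_complex x))"
    proof (rule homeomorphismI)
      show "continuous_on {t0 - 1<..<t0 + 1} (\<lambda>t. to_plane (\<Phi> t))"
        using \<Phi>_cont by (intro continuous_intros) (auto intro: continuous_on_subset)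
      show "continuous_on (\<Gamma> \<inter> U) (\<lambda>x. \<iota> (to_complex x))"
        by (rule continuous_on_subset[OF cont]) (auto simp: U_def)
    qed (use \<Phi>_slit in \<open>auto simp: U_def \<Gamma>_def D_def \<iota>_\<Phi>\<close>)
    moreover have "vector_derivative (\<lambda>t. to_plane (\<Phi> t)) (at t) \<noteq> 0" for t
    proof -
      have "((\<lambda>t. to_plane (\<Phi> t)) has_vector_derivative to_plane (deriv \<Psi> (of_real t))) (at t)"
        by (rule bounded_linear.has_vector_derivative[OF bounded_linear_to_plane has_vector_derivative_\<Phi>])
      moreover have "to_plane (deriv \<Psi> (of_real t)) \<noteq> 0"
        using \<Psi>_deriv_nz[of t] by (metis to_complex_to_plane linear_0[OF linear_to_complex])
      ultimately show ?thesis by (simp add: vector_derivative_at)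
    qed
    ultimately show "\<exists>U a b \<gamma> \<delta>. open U \<and> p \<in> U \<and> homeomorphism {a<..<b} (\<Gamma> \<inter> U) \<gamma> \<delta> \<and>
        \<gamma> real_analytic_on {a<..<b} \<and> (\<forall>t\<in>{a<..<b}. vector_derivative \<gamma> (at t) \<noteq> 0)"
      using real_analytic_\<Phi> by blast
  qed
qed

lemma connected_\<Gamma>: "connected \<Gamma>"
proof -
  have "continuous_on UNIV (\<lambda>t. to_plane (\<Phi> t))" by (intro continuous_intros \<Phi>_cont)
  then have "connected (range (\<lambda>t. to_plane (\<Phi> t)))"
    by (rule connected_continuous_image) simp
  then show ?thesis by (simp add: \<Gamma>_def image_image)
qed

lemma continuous_on_w: "continuous_on D w"
  unfolding w_def
  by (intro continuous_intros continuous_on_compose2[OF u_cont]) (auto simp: D_def)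

lemma continuous_on_closure_w: "continuous_on (closure \<Omega>) w"
  unfolding w_def \<Omega>_def closure_to_plane
  by (intro continuous_intros continuous_on_compose2[OF u_cont_closure]) auto

section \<open>First and second derivatives of \<open>w\<close>\<close>

definition G :: "complex \<Rightarrow> complex" where "G z = h z - cnj z / 2"

text \<open>The partial derivatives of \<open>w\<close> in closed form: the factor 1/2 is the
  dilation 2 divided by 4, and the minus sign comes from
  \<open>Re (G z * \<i>) = - Im (G z)\<close>.\<close>

definition P :: "2 \<Rightarrow> real ^ 2 \<Rightarrow> real" where
  "P i x = (if i = 1 then Re (G (to_complex x)) / 2 else - Im (G (to_complex x)) / 2)"

definition dG :: "real ^ 2 \<Rightarrow> real ^ 2 \<Rightarrow> complex" where
  "dG x v = deriv h (to_complex x) * to_complex v - cnj (to_complex v) / 2"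

lemma h_hol: "h holomorphic_on slit_plane"
proof -
  have "F holomorphic_on slit_plane"
    using F_deriv open_slit_plane by (auto simp: holomorphic_on_open)
  then have "deriv F holomorphic_on slit_plane"
    using open_slit_plane by (rule holomorphic_deriv)
  then show ?thesis
    by (rule holomorphic_transform) (use F_deriv DERIV_imp_deriv in blast)
qed

lemma w_has_derivative:
  assumes "x \<in> D"
  shows "(w has_derivative (\<lambda>v. (\<chi> i. P i x) \<bullet> v)) (at x)"
proof -
  have "((\<lambda>x. u (to_complex x)) has_derivative (\<lambda>v. Re (G (to_complex x) * to_complex v))) (at x)"
    unfolding G_def using assms
    by (intro has_derivative_compose[OF bounded_linear_imp_has_derivative[OF bounded_linear_to_complex] u_has_derivative])
       (simp add: D_def)
  then have "(w has_derivative (\<lambda>v. Re (G (to_complex x) * to_complex v) / 4)) (at x)"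
    unfolding w_def by (auto intro!: derivative_eq_intros)
  also have "(\<lambda>v. Re (G (to_complex x) * to_complex v) / 4) = (\<lambda>v. (\<chi> i. P i x) \<bullet> v)"
    by (auto simp: inner_vec_def sum_2 P_def to_complex_def[of _] algebra_simps field_simps)
  finally show ?thesis .
qed

lemma partial_w: "x \<in> D \<Longrightarrow> partial_derivative i w x = P i x"
  using partial_derivativeI[OF w_has_derivative] by (simp add: inner_axis)

lemma grad_w: "x \<in> D \<Longrightarrow> grad w x = (\<chi> i. P i x)"
  by (simp add: grad_def partial_w)

lemma G_has_derivative:
  assumes "x \<in> D"
  shows "((\<lambda>x. G (to_complex x)) has_derivative dG x) (at x)"
proof -
  have "(h has_derivative (*) (deriv h (to_complex x))) (at (to_complex x))"
    using holomorphic_derivI[OF h_hol open_slit_plane] assms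
    by (simp add: D_def has_field_derivative_def)
  then have "((\<lambda>x. h (to_complex x)) has_derivative (\<lambda>v. deriv h (to_complex x) * to_complex v)) (at x)"
    by (rule has_derivative_compose[OF bounded_linear_imp_has_derivative[OF bounded_linear_to_complex]])
  moreover have "((\<lambda>x. cnj (to_complex x)) has_derivative (\<lambda>v. cnj (to_complex v))) (at x)"
    by (intro has_derivative_cnj bounded_linear_imp_has_derivative bounded_linear_to_complex)
  ultimately show ?thesis
    unfolding G_def dG_def
    by (intro has_derivative_diff bounded_linear.has_derivative[OF bounded_linear_divide])
qed

lemma partial_w_has_derivative:
  assumes "x \<in> D"
  shows "(partial_derivative i w has_derivative
    (\<lambda>v. if i = 1 then Re (dG x v) / 2 else - Im (dG x v) / 2)) (at x)"
proof (rule has_derivative_transform_within_open[OF _ open_D assms])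
  show "(P i has_derivative (\<lambda>v. if i = 1 then Re (dG x v) / 2 else - Im (dG x v) / 2)) (at x)"
    unfolding P_def using G_has_derivative[OF assms]
    by (cases "i = 1") (auto intro!: derivative_eq_intros)
qed (simp add: partial_w)

lemma partial2_w:
  assumes "x \<in> D"
  shows "partial_derivative j (partial_derivative i w) x =
    (if i = 1 then Re (dG x (axis j 1)) / 2 else - Im (dG x (axis j 1)) / 2)"
  by (rule partial_derivativeI[OF partial_w_has_derivative[OF assms]])

lemma continuous_on_P: "continuous_on D (P i)"
proof -
  have "continuous_on D (\<lambda>x. h (to_complex x))"
    by (intro continuous_on_compose2[OF holomorphic_on_imp_continuous_on[OF h_hol]] continuous_intros)
       (auto simp: D_def)
  then show ?thesis
    unfolding P_def G_def by (cases "i = 1") (auto intro!: continuous_intros)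
qed

lemma continuous_on_partial2: "continuous_on D (partial_derivative j (partial_derivative i w))"
proof -
  have "deriv h holomorphic_on slit_plane" using h_hol open_slit_plane by (rule holomorphic_deriv)
  from continuous_on_compose2[OF holomorphic_on_imp_continuous_on[OF this], of D to_complex]
  have "continuous_on D (\<lambda>x. deriv h (to_complex x))"
    by (simp add: D_def continuous_on_to_complex image_subset_iff)
  then have "continuous_on D (\<lambda>x. if i = 1 then Re (dG x (axis j 1)) / 2 else - Im (dG x (axis j 1)) / 2)"
    unfolding dG_def by (cases "i = 1") (auto intro!: continuous_intros)
  then show ?thesis
    by (rule continuous_on_eq) (simp add: partial2_w)
qed

lemma Ck_w: "Ck_on 2 w \<Omega>" "Ck_on 1 w \<Omega>"
proof -
  have "w differentiable (at x)" "partial_derivative i w differentiable (at x)" if "x \<in> \<Omega>" for x i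
    using that \<Omega>_subset w_has_derivative[of x] partial_w_has_derivative[of x i]
    by (auto simp: differentiable_def)
  moreover have "continuous_on \<Omega> (partial_derivative j (partial_derivative i w))" for i j
    by (rule continuous_on_subset[OF continuous_on_partial2 \<Omega>_subset])
  moreover have "continuous_on \<Omega> (partial_derivative i w)" for i
    by (rule continuous_on_eq[OF continuous_on_subset[OF continuous_on_P \<Omega>_subset]])
       (use \<Omega>_subset partial_w in auto)
  ultimately show "Ck_on 2 w \<Omega>" "Ck_on 1 w \<Omega>"
    by (simp_all add: numeral_2_eq_2)
qed

lemma C1_up_to_w: "C1_up_to w \<Omega> \<Gamma>"
  unfolding C1_up_to_def
proof (intro conjI allI)
  show "continuous_on (\<Omega> \<union> \<Gamma>) w"
    using continuous_on_subset[OF continuous_on_w] \<Omega>_subset \<Gamma>_subset by simp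
  fix i
  show "\<exists>g. continuous_on (\<Omega> \<union> \<Gamma>) g \<and> (\<forall>x\<in>\<Omega>. g x = partial_derivative i w x)"
    using continuous_on_subset[OF continuous_on_P[of i]] \<Omega>_subset \<Gamma>_subset partial_w
    by (intro exI[of _ "P i"]) (auto simp: subset_iff)
qed (rule Ck_w)

text \<open>The contributions of \<open>deriv h\<close> along the two axes cancel, as
  \<open>Re F\<close> is harmonic; each conjugate term contributes -1/2.\<close>

lemma laplacian_w:
  assumes "x \<in> \<Omega>"
  shows "- laplacian w x = 1"
proof -
  have "x \<in> D" using assms \<Omega>_subset by blast
  have a: "to_complex (axis 1 1) = 2" "to_complex (axis 2 1) = 2 * \<i>"
    by (simp_all add: to_complex_def axis_def complex_eq_iff)
  show ?thesis
    by (simp add: laplacian_def sum_2 partial2_w[OF \<open>x \<in> D\<close>] dG_def a field_simps)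
qed

text \<open>The arc lies inside the open set \<open>D\<close> where \<open>w\<close> is smooth, so
  the outer normal is the normalized negative gradient of \<open>w\<close> at
  \<open>p\<close>.\<close>

lemma normal_derivative:
  assumes "p \<in> \<Gamma>"
  shows "has_normal_derivative w (- (1/4)) \<Omega> p"
proof -
  define g where "g = (\<chi> i. P i p)"
  \<comment> \<open>The gradient points into the domain and has length 1/4 by
    \<open>\<Phi>_grad\<close>, so this is a unit vector pointing outwards.\<close>
  define \<nu> where "\<nu> = - 4 *\<^sub>R g"
  have pD: "p \<in> D" using assms \<Gamma>_subset by blast
  obtain t0 where t0: "p = to_plane (\<Phi> t0)" using assms by (auto simp: \<Gamma>_def)
  have der: "(w has_derivative (\<lambda>v. g \<bullet> v)) (at p)"
    unfolding g_def by (rule w_has_derivative[OF pD])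
  have "g \<bullet> g = (norm (G (\<Phi> t0)))\<^sup>2 / 4"
    unfolding cmod_power2 by (simp add: g_def inner_vec_def sum_2 P_def t0 power2_eq_square)
  then have gg: "g \<bullet> g = 1/16"
    using \<Phi>_grad[of t0] by (simp add: G_def power2_eq_square)
  have wp: "w p = 0" by (simp add: w_def t0 u_\<Phi>)
  have line: "((\<lambda>t. w (p + t *\<^sub>R v)) has_real_derivative g \<bullet> v) (at 0)" for v
  proof -
    have "((\<lambda>t. p + t *\<^sub>R v) has_derivative (\<lambda>t. t *\<^sub>R v)) (at 0)"
      by (auto intro!: derivative_eq_intros)
    then have "((\<lambda>t. w (p + t *\<^sub>R v)) has_derivative (\<lambda>t. g \<bullet> (t *\<^sub>R v))) (at 0)"
      by (rule has_derivative_compose) (simp add: der)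
    moreover have "(\<lambda>t. g \<bullet> (t *\<^sub>R v)) = (*) (g \<bullet> v)" by (auto simp: mult.commute)
    ultimately show ?thesis by (simp only: has_field_derivative_def)
  qed
  have inD: "\<forall>\<^sub>F t in at_right 0. p + t *\<^sub>R v \<in> D" for v
  proof -
    have "((\<lambda>t. p + t *\<^sub>R v) \<longlongrightarrow> p + 0 *\<^sub>R v) (at_right 0)"
      by (intro tendsto_intros)
    then show ?thesis using topological_tendstoD[OF _ open_D] pD by auto
  qed
  have "is_unit_outer_normal \<Omega> p \<nu>"
    unfolding is_unit_outer_normal_def
  proof (intro conjI ballI)
    show "norm \<nu> = 1"
      using gg by (simp add: \<nu>_def norm_eq_sqrt_inner real_sqrt_divide)
  next
    fix v assume "v \<in> tangent_vectors (frontier \<Omega>) p"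
    then obtain \<gamma> e where \<gamma>: "e > 0" "\<gamma> ` {-e<..<e} \<subseteq> frontier \<Omega>" "\<gamma> 0 = p"
      "(\<gamma> has_vector_derivative v) (at (0::real))"
      by (auto simp: tangent_vectors_def)
    have "((\<lambda>t. w (\<gamma> t)) has_derivative (\<lambda>t. g \<bullet> (t *\<^sub>R v))) (at 0)"
      by (rule has_derivative_compose[OF \<gamma>(4)[unfolded has_vector_derivative_def]])
         (simp add: \<gamma>(3) der)
    \<comment> \<open>\<open>w\<close> vanishes on the whole frontier, so its derivative along any
      curve in the frontier is 0 and the gradient annihilates \<open>v\<close>.\<close>
    moreover have "((\<lambda>t. w (\<gamma> t)) has_derivative (\<lambda>t. 0)) (at 0)"
    proof (rule has_derivative_transform_within_open)
      show "((\<lambda>t. 0) has_derivative (\<lambda>t. 0)) (at (0::real))" by (rule has_derivative_const)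
      show "(0::real) \<in> {-e<..<e}" using \<gamma>(1) by simp
      show "0 = w (\<gamma> t)" if "t \<in> {-e<..<e}" for t
        using w_frontier that \<gamma>(2) by force
    qed simp
    ultimately have "(\<lambda>t. g \<bullet> (t *\<^sub>R v)) = (\<lambda>t. 0)" by (rule has_derivative_unique)
    then have "g \<bullet> (1 *\<^sub>R v) = 0" by meson
    then show "\<nu> \<bullet> v = 0" by (simp add: \<nu>_def)
  next
    \<comment> \<open>The signs of the directional derivatives decide the two sides:
      \<open>w\<close> is positive just inside and negative just outside, while it is nonnegative on
      the closure of the domain.\<close>
    have "g \<bullet> (- \<nu>) = 1/4" "g \<bullet> \<nu> = - (1/4)" using gg by (simp_all add: \<nu>_def)
    then have "g \<bullet> (- \<nu>) > 0" "g \<bullet> \<nu> < 0" by simp_all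
    from DERIV_pos_inc_right[OF line this(1)] DERIV_neg_dec_right[OF line this(2)]
    obtain d1 d2 where d: "d1 > 0" "\<And>t. 0 < t \<Longrightarrow> t < d1 \<Longrightarrow> w (p + t *\<^sub>R (- \<nu>)) > 0"
      "d2 > 0" "\<And>t. 0 < t \<Longrightarrow> t < d2 \<Longrightarrow> w (p + t *\<^sub>R \<nu>) < 0"
      by (auto simp: wp)
    have "\<forall>\<^sub>F t in at_right 0. t \<in> {0<..<min d1 d2}"
      using d by (intro eventually_at_right_real) auto
    then show "\<forall>\<^sub>F t in at_right 0. p - t *\<^sub>R \<nu> \<in> \<Omega> \<and> p + t *\<^sub>R \<nu> \<notin> closure \<Omega>"
      using inD[of "- \<nu>"] inD[of \<nu>]
    proof eventually_elim
      case (elim t)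
      then have "w (p - t *\<^sub>R \<nu>) > 0" "w (p + t *\<^sub>R \<nu>) < 0" "p - t *\<^sub>R \<nu> \<in> D"
        using d(2)[of t] d(4)[of t] by auto
      moreover have "w x \<ge> 0" if "x \<in> closure \<Omega>" for x
      proof -
        have "to_complex x \<in> closure Om" using that by (auto simp: \<Omega>_def closure_to_plane)
        then show ?thesis
          using closure_Om one_notin_slit[of 1] one_notin_slit[of "-1"] by (auto simp: w_def u_def)
      qed
      ultimately show ?case
        by (force simp: \<Omega>_iff Om_def w_def D_def)
    qed
  qed
  moreover have "(grad w \<longlongrightarrow> g) (at p within \<Omega>)"
  proof -
    have "(P i \<longlongrightarrow> P i p) (at p)" for i
      using continuous_on_P[of i] open_D pD continuous_on_eq_continuous_at isCont_def by blast
    then have "((\<lambda>x. \<chi> i. P i x) \<longlongrightarrow> g) (at p)"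
      unfolding g_def by (intro tendsto_vec_lambda)
    then have "((\<lambda>x. \<chi> i. P i x) \<longlongrightarrow> g) (at p within \<Omega>)"
      by (rule tendsto_within_subset) simp
    then show ?thesis
      by (rule Lim_transform_eventually) (use \<Omega>_subset grad_w in \<open>auto simp: eventually_at_filter subset_iff intro!: always_eventually\<close>)
  qed
  moreover have "g \<bullet> \<nu> = - (1/4)" using gg by (simp add: \<nu>_def)
  ultimately show ?thesis unfolding has_normal_derivative_def by blast
qed

end

section \<open>Assembling the example\<close>

context strip_perturbation
begin

text \<open>The real part of the strip coordinate serves as the inverse chart, because
  \<open>S (\<Phi> t)\<close> is \<open>t - \<i> * (pi / 4)\<close>.\<close>

lemma overdetermined_arc_exists:
  assumes "\<kappa> a \<noteq> \<kappa> b"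
  obtains F h where "overdetermined_arc F h \<Phi> \<Psi> (\<lambda>z. Re (S z))"
proof -
  obtain F h where "slit_potential F h \<Phi>" by (rule potential_exists)
  then interpret slit_potential F h \<Phi> .
  have "overdetermined_arc F h \<Phi> \<Psi> (\<lambda>z. Re (S z))"
  proof
    show "\<Psi> holomorphic_on {c. \<bar>Im c\<bar> < 1/2}"
      unfolding holomorphic_on_open[OF open_Im_strip] using \<Psi>_deriv by blast
    show "continuous_on slit_plane (\<lambda>z. Re (S z))"
      by (intro continuous_intros holomorphic_on_imp_continuous_on S_hol)
    show "\<Phi> t = \<Psi> (of_real t)" for t by (simp add: \<Phi>_def)
    show "deriv \<Psi> (of_real t) \<noteq> 0" for t
      using DERIV_imp_deriv[OF \<Psi>_deriv[of "of_real t"]] cosh_E_line[of "of_real t"]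
        one_plus_deriv_k(2)[OF line_in[of "of_real t"]] by simp
    show "Re (S (\<Phi> t)) = t" for t
      using S_\<Psi>[of "of_real t"] by (simp add: \<Phi>_def line_def)
    show "\<not> (\<forall>t. (norm (\<Phi> t))\<^sup>2 - 1 = y * Im (\<Phi> t))" for y
      using curve_not_circular[of y a b] assms by blast
  qed
  then show ?thesis by (rule that)
qed

end

theorem theorem2p1:
  shows "\<exists>(\<Omega> :: (real ^ 2) set) (\<Gamma> :: (real ^ 2) set) (c :: real) (u :: real ^ 2 \<Rightarrow> real).
    planar_domain \<Omega> \<and> starlike \<Omega> \<and>
    \<Omega> \<subseteq> {x. \<forall>i. -1 < x $ i \<and> x $ i < 1} \<and>
    \<not> (\<exists>a r. \<Omega> = ball a r) \<and>
    \<Gamma> \<noteq> {} \<and> connected \<Gamma> \<and> analytic_boundary_subset \<Omega> \<Gamma> \<and>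
    c > 0 \<and>
    continuous_on (closure \<Omega>) u \<and> C1_up_to u \<Omega> \<Gamma> \<and> Ck_on 2 u \<Omega> \<and>
    (\<forall>x\<in>\<Omega>. - laplacian u x = 1) \<and>
    (\<forall>x\<in>frontier \<Omega>. u x = 0) \<and>
    (\<forall>x\<in>\<Gamma>. has_normal_derivative u (- c) \<Omega> x)"
proof -
  interpret P: strip_perturbation pert pert_real by (rule strip_perturbation_pert)
  obtain F h where "overdetermined_arc F h P.\<Phi> P.\<Psi> (\<lambda>z. Re (P.S z))"
    using P.overdetermined_arc_exists[OF pert_real_nonconstant] by blast
  then interpret overdetermined_arc F h P.\<Phi> P.\<Psi> "\<lambda>z. Re (P.S z)" .
  have "starlike \<Omega>" "\<Gamma> \<noteq> {}" "(0::real) < 1/4"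
    by (simp_all add: starlike_\<Omega> \<Gamma>_def)
  then show ?thesis
    using planar_domain_\<Omega> \<Omega>_in_square not_ball connected_\<Gamma> analytic_\<Gamma> continuous_on_closure_w
      C1_up_to_w Ck_w(1) laplacian_w w_frontier normal_derivative
    by (intro exI[of _ \<Omega>] exI[of _ \<Gamma>] exI[of _ "1/4"] exI[of _ w]) blast
qed

end
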